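(* Let $f:(\mathbb{R}^n\setminus\mathcal{C})\times U\to\mathbb{R}^n$ be continuous and suppose there is a strictly increasing bijection $\nu:[0,+\infty)\to[0,+\infty)$ such that the rescaled dynamics $\bar f(x,u):=\frac{f(x,u)}{1+\nu(|u|)}$ is uniformly continuous on $\mathcal{K}\times U$ for every compact set $\mathcal{K}\subset\mathbb{R}^n\setminus\mathcal{C}$ and bounded on $(B_R(\mathcal{C})\setminus\mathcal{C})\times U$ for every $R>0$. Let $\sigma:(0,+\infty)\to(0,+\infty)$ be a continuous function. Then the original control system $\dot x=f(x,u)$, $u\in U$, is GAC to $\mathcal{C}$ with $U\cap\sigma$ controls if and only if the rescaled control system $y'=\bar f(y,v)$, $v\in U$, is GAC to $\mathcal{C}$ with $U\cap\sigma$ controls (for the same $\sigma$).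
   Context: Standing setting. $\mathcal{C}\subset\mathbb{R}^n$ is a nonempty closed set with compact boundary, $U\subseteq\mathbb{R}^m$ is a closed cone, $\mathbf d(x):=\mathrm{dist}(x,\mathcal{C})$ is the Euclidean distance from $\mathcal{C}$, and $B_R(\mathcal{C}):=\{x\in\mathbb{R}^n:\mathbf d(x)\le R\}$. In the following definitions $g:(\mathbb{R}^n\setminus\mathcal{C})\times U\to\mathbb{R}^n$ is continuous; they are applied to $g=f$ and $g=\bar f$. $\mathcal{KL}$ functions (descent rates): continuous $\beta:[0,+\infty)^2\to[0,+\infty)$ such that $\beta(0,t)=0$ and $\beta(\cdot,t)$ is strictly increasing and unbounded for each $t\ge0$; $\beta(r,\cdot)$ is strictly decreasing for each $r>0$; $\beta(r,t)\to0$ as $t\to+\infty$ for each $r\ge0$. Admissible pair for $(g,U)$: a pair $(x,u)$ for which there is $T_x\in(0,+\infty]$ such that $u\in L^\infty_{loc}([0,T_x),U)$ (essentially bounded on compact subsets), $x:[0,T_x)\to\mathbb{R}^n\setminus\mathcal{C}$ is locally absolutely continuous, $\dot x(t)=g(x(t),u(t))$ for a.e. $t\in[0,T_x)$, and, if $T_x<+\infty$, $\lim_{t\to T_x^-}\mathbf d(x(t))=0$. If $T_x<+\infty$, $x$ is extended to $[0,+\infty)$ by setting $x(t):=\bar z$ for $t\ge T_x$, where $\bar z\in\partial\mathcal{C}$ is an arbitrary point of the form $\bar z=\lim_i x(\tau_i)$ for some $\tau_i\uparrow T_x$. GAC with $U\cap\sigma$ controls. The system $\dot x=g(x,u)$,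 $u\in U$, is globally asymptotically controllable (GAC) to $\mathcal{C}$ with $U\cap\sigma$ controls if there is $\beta\in\mathcal{KL}$ such that for every $z\in\mathbb{R}^n\setminus\mathcal{C}$ there is an admissible pair $(x,u)$ for $(g,U)$ with $x(0)=z$, $\mathbf d(x(t))\le\beta(\mathbf d(z),t)$ for all $t\ge0$, and $|u(t)|\le\sigma(\mathbf d(x(t)))$ for a.e. $t\in[0,T_x)$. *)

theory Defs
  imports "HOL-Analysis.Analysis"
begin

definition abs_continuous_on :: "real set \<Rightarrow> (real \<Rightarrow> 'a::real_normed_vector) \<Rightarrow> bool" where
  "abs_continuous_on S x \<longleftrightarrow>
     (\<forall>\<epsilon>>0. \<exists>\<delta>>0. \<forall>(N::nat) a b.
        (\<forall>i<N. a i \<le> b i \<and> {a i..b i} \<subseteq> S) \<longrightarrow>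
        disjoint_family_on (\<lambda>i. {a i<..<b i}) {..<N} \<longrightarrow>
        (\<Sum>i<N. b i - a i) < \<delta> \<longrightarrow>
        (\<Sum>i<N. norm (x (b i) - x (a i))) < \<epsilon>)"

definition locally_abs_continuous_on :: "real set \<Rightarrow> (real \<Rightarrow> 'a::real_normed_vector) \<Rightarrow> bool" where
  "locally_abs_continuous_on I x \<longleftrightarrow> (\<forall>a b. {a..b} \<subseteq> I \<longrightarrow> abs_continuous_on {a..b} x)"

definition time_dom :: "ereal \<Rightarrow> real set" where
  "time_dom T = {t. 0 \<le> t \<and> ereal t < T}"

definition Linf_loc :: "real set \<Rightarrow> 'a::euclidean_space set \<Rightarrow> (real \<Rightarrow> 'a) \<Rightarrow> bool" where
  "Linf_loc I U u \<longleftrightarrow>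
     u \<in> borel_measurable (lebesgue_on I) \<and>
     (\<forall>t\<in>I. u t \<in> U) \<and>
     (\<forall>K. compact K \<and> K \<subseteq> I \<longrightarrow> (\<exists>M. AE t in lebesgue_on K. norm (u t) \<le> M))"

definition class_KL :: "(real \<Rightarrow> real \<Rightarrow> real) \<Rightarrow> bool" where
  "class_KL \<beta> \<longleftrightarrow>
     continuous_on ({0..} \<times> {0..}) (\<lambda>(r, t). \<beta> r t) \<and>
     (\<forall>r\<ge>0. \<forall>t\<ge>0. 0 \<le> \<beta> r t) \<and>
     (\<forall>t\<ge>0. \<beta> 0 t = 0 \<and> strict_mono_on {0..} (\<lambda>r. \<beta> r t) \<and>
              \<not> bdd_above ((\<lambda>r. \<beta> r t) ` {0..})) \<and>
     (\<forall>r>0. strict_antimono_on {0..} (\<beta> r)) \<and>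
     (\<forall>r\<ge>0. (\<beta> r \<longlongrightarrow> 0) at_top)"

text \<open>Only the values of \<open>x\<close> and \<open>u\<close> on \<open>time_dom T\<close> matter here.\<close>

definition admissible_pair ::
  "('a::euclidean_space) set \<Rightarrow> ('b::euclidean_space) set \<Rightarrow> ('a \<Rightarrow> 'b \<Rightarrow> 'a) \<Rightarrow>
   ereal \<Rightarrow> (real \<Rightarrow> 'a) \<Rightarrow> (real \<Rightarrow> 'b) \<Rightarrow> bool" where
  "admissible_pair C U g T x u \<longleftrightarrow>
     0 < T \<and>
     Linf_loc (time_dom T) U u \<and>
     (\<forall>t\<in>time_dom T. x t \<notin> C) \<and>
     locally_abs_continuous_on (time_dom T) x \<and>
     (AE t in lebesgue_on (time_dom T). (x has_vector_derivative g (x t) (u t)) (at t)) \<and>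
     (T < \<infinity> \<longrightarrow> ((\<lambda>t. infdist (x t) C) \<longlongrightarrow> 0) (at_left (real_of_ereal T)))"

text \<open>The total function \<open>x\<close> carries the extension of the trajectory from \<open>time_dom T\<close> to
  \<open>{0..}\<close>: past a finite \<open>T\<close> it is constantly equal to a boundary limit point.\<close>

definition extended_past :: "('a::euclidean_space) set \<Rightarrow> ereal \<Rightarrow> (real \<Rightarrow> 'a) \<Rightarrow> bool" where
  "extended_past C T x \<longleftrightarrow>
     (T < \<infinity> \<longrightarrow>
       (\<exists>z\<in>frontier C. \<exists>\<tau>::nat \<Rightarrow> real.
          range \<tau> \<subseteq> time_dom T \<and> incseq \<tau> \<and> \<tau> \<longlonglongrightarrow> real_of_ereal T \<and>
          (\<lambda>i. x (\<tau> i)) \<longlonglongrightarrow> z \<and>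
          (\<forall>t\<ge>real_of_ereal T. x t = z)))"

definition GAC ::
  "('a::euclidean_space) set \<Rightarrow> ('b::euclidean_space) set \<Rightarrow> (real \<Rightarrow> real) \<Rightarrow>
   ('a \<Rightarrow> 'b \<Rightarrow> 'a) \<Rightarrow> bool" where
  "GAC C U \<sigma> g \<longleftrightarrow>
     (\<exists>\<beta>. class_KL \<beta> \<and>
       (\<forall>z. z \<notin> C \<longrightarrow>
         (\<exists>T x u. admissible_pair C U g T x u \<and> extended_past C T x \<and>
            x 0 = z \<and>
            (\<forall>t\<ge>0. infdist (x t) C \<le> \<beta> (infdist z C) t) \<and>
            (AE t in lebesgue_on (time_dom T). norm (u t) \<le> \<sigma> (infdist (x t) C)))))"

definition rescaled ::
  "(real \<Rightarrow> real) \<Rightarrow> ('a::real_normed_vector \<Rightarrow> 'b::real_normed_vector \<Rightarrow> 'a) \<Rightarrow> 'a \<Rightarrow> 'b \<Rightarrow> 'a" where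
  "rescaled \<nu> f x u = f x u /\<^sub>R (1 + \<nu> (norm u))"

end

theory Submission
  imports Defs
begin

text \<open>
  Both dynamics differ by a positive factor \<open>h (norm u)\<close> that, together with its inverse, is bounded
  on bounded sets of controls, so trajectories correspond under the time change
  \<open>s = \<integral> h (norm (u t)) dt\<close>; both implications are instances of one statement (\<open>GAC_rescale\<close>).
  The new descent rate needs care: a single trajectory may come very close to \<open>C\<close>, where \<open>\<sigma>\<close> and hence
  the controls may be huge, and then move away again, so the stretched time until it
  settles is not controlled uniformly. Therefore each trajectory is followed only until its distance
  from \<open>C\<close> reaches the next power of 2. Up to then the distance ranges over a
  compact subset of \<open>(0, \<infinity>)\<close>, where \<open>\<sigma>\<close> is bounded, so the rescaled duration is bounded in terms of the
  dyadic level alone. Concatenating such pieces gives trajectories whose level drops at times that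
  depend only on the initial level, and this is turned into a KL estimate.
\<close>

section \<open>Lebesgue differentiation of bounded functions on the line\<close>

text \<open>Controls are only measurable, yet admissibility asks for a pointwise derivative almost
  everywhere. So the new clock F must satisfy F' = h(norm u) at almost every point, which is
  Lebesgue's differentiation theorem; the chain rule then turns x' = f into y' = f / h. While norm u
  stays below a constant M on a piece, the clock is bi-Lipschitz, and null sets, measurable sets and
  absolute continuity survive the change of variable.

  A piece that starts at distance at most D may rise to \<beta>(D, 0) before it falls. Each new
  level therefore starts a fresh trajectory of the original system: its overshoot is measured from
  the current level and not from the initial point, so it shrinks with the levels. This is why the
  new rate has to dominate \<beta>(2^(k-j+1), 0) for as long as piece j may last. The durations may
  have a finite or an infinite sum; in the finite case compactness of the frontier provides the
  limit point that extends the trajectory.\<close>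

lemma negligible_vitali_upper_derivate:
  fixes q F :: "real \<Rightarrow> real"
  assumes q: "q \<in> borel_measurable lebesgue" and B: "\<And>t. \<bar>q t\<bar> \<le> B"
    and F: "\<And>a b. a \<le> b \<Longrightarrow> (q has_integral (F b - F a)) {a..b}"
    and "p < r"
  shows "negligible {t. q t < p \<and>
           (\<forall>d>0. \<exists>a b. a < b \<and> t \<in> {a..b} \<and> b - a < d \<and> r * (b - a) < F b - F a)}"
    (is "negligible ?E")
proof (subst negligible_outer_le, intro allI impI)
  fix e :: real assume "e > 0"
  \<comment> \<open>Vitali intervals inside a tight open cover \<open>G\<close> of \<open>{q < p}\<close>: on their union \<open>q\<close> has mean
    above \<open>r\<close>, but exceeds \<open>p\<close> only on the small set \<open>G - {q < p}\<close>.\<close>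
  define M where "M = B + \<bar>p\<bar> + 1"
  have "B \<ge> 0" using B[of 0] by linarith
  then have "M > 0" by (simp add: M_def)
  define \<epsilon> where "\<epsilon> = e * (r - p) / M"
  have "\<epsilon> > 0" using \<open>e > 0\<close> \<open>p < r\<close> \<open>M > 0\<close> by (simp add: \<epsilon>_def)
  let ?A = "{t. q t < p}"
  have Am: "?A \<in> sets lebesgue"
    using borel_measurable_less[OF q, of "\<lambda>_. p"] by simp
  obtain G where G: "open G" "?A \<subseteq> G" "G - ?A \<in> lmeasurable" "emeasure lebesgue (G - ?A) < ennreal \<epsilon>"
    using sets_lebesgue_outer_open[OF Am \<open>\<epsilon> > 0\<close>] by metis
  have G\<epsilon>: "measure lebesgue (G - ?A) < \<epsilon>"
    using G(3,4) \<open>\<epsilon> > 0\<close> by (simp add: emeasure_eq_measure2 ennreal_less_iff)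
  define K where "K = {(a, b). a < b \<and> {a..b} \<subseteq> G \<and> r * (b - a) < F b - F a}"
  define c where "c = (\<lambda>(a::real, b::real). (a + b) / 2)"
  define rad where "rad = (\<lambda>(a::real, b::real). (b - a) / 2)"
  have cball: "cball (c i) (rad i) = {fst i..snd i}" for i
    by (cases i) (auto simp: c_def rad_def cball_eq_atLeastAtMost field_simps)
  have cover: "\<exists>i. i \<in> K \<and> t \<in> cball (c i) (rad i) \<and> rad i < d" if t: "t \<in> ?E" and "d > 0" for t d
  proof -
    have "t \<in> G" using t G by auto
    then obtain \<eta> where \<eta>: "\<eta> > 0" "ball t \<eta> \<subseteq> G" using \<open>open G\<close> openE by blast
    have "\<forall>d>0. \<exists>a b. a < b \<and> t \<in> {a..b} \<and> b - a < d \<and> r * (b - a) < F b - F a"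
      using t by simp
    moreover have pos: "min d \<eta> > 0" using \<open>d > 0\<close> \<eta> by simp
    ultimately have "\<exists>a b. a < b \<and> t \<in> {a..b} \<and> b - a < min d \<eta> \<and> r * (b - a) < F b - F a"
      by (rule spec[of _ "min d \<eta>", THEN mp])
    then obtain a b where ab: "a < b" "t \<in> {a..b}" "b - a < min d \<eta>" "r * (b - a) < F b - F a"
      by (elim exE conjE) (rule that)
    have "{a..b} \<subseteq> ball t \<eta>"
      using ab by (auto simp: dist_real_def)
    then have "(a, b) \<in> K" using ab \<eta> by (auto simp: K_def)
    moreover have "t \<in> cball (c (a,b)) (rad (a,b))" unfolding cball using ab by simp
    moreover have "rad (a,b) < d" using ab by (simp add: rad_def)
    ultimately show ?thesis by blast
  qed
  have rad_pos: "0 < rad i" if "i \<in> K" for i using that by (auto simp: K_def rad_def)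
  obtain D where D: "countable D" "D \<subseteq> K"
     "pairwise (\<lambda>i j. disjnt (cball (c i) (rad i)) (cball (c j) (rad j))) D"
     "negligible (?E - (\<Union>i \<in> D. cball (c i) (rad i)))"
    by (rule Vitali_covering_theorem_cballs[of K rad ?E c, OF rad_pos cover])
  define I where "I i = {fst i..snd i}" for i :: "real \<times> real"
  have I: "cball (c i) (rad i) = I i" for i by (simp add: cball I_def)
  have piece: "(r - p) * measure lebesgue (I i) \<le> M * measure lebesgue (I i \<inter> (G - ?A))" if "i \<in> D" for i
  proof -
    obtain a b where i: "i = (a,b)" by force
    have ab: "a < b" "{a..b} \<subseteq> G" "r * (b - a) < F b - F a" using that D i by (auto simp: K_def)
    have m: "{a..b} \<inter> (G - ?A) \<in> lmeasurable" using G(3) by (simp add: fmeasurable.Int)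
    have 1: "((\<lambda>t. p + M * indicator ({a..b} \<inter> (G - ?A)) t) has_integral 
       (p * (b - a) + M * measure lebesgue ({a..b} \<inter> (G - ?A)))) {a..b}"
    proof (rule has_integral_add)
      show "((\<lambda>t. p) has_integral p * (b - a)) {a..b}" using has_integral_const_real[of p a b] ab by (simp add: mult.commute)
      have "((\<lambda>t. indicator ({a..b} \<inter> (G - ?A)) t::real) has_integral measure lebesgue ({a..b} \<inter> (G - ?A))) {a..b}"
      proof (subst has_integral_restrict_UNIV[symmetric])
        have "(\<lambda>t. if t \<in> {a..b} then indicator ({a..b} \<inter> (G - ?A)) t else 0) = (indicator ({a..b} \<inter> (G - ?A)) :: real \<Rightarrow> real)"
          by (auto simp: indicator_def)
        then show "((\<lambda>t. if t \<in> {a..b} then indicator ({a..b} \<inter> (G - ?A)) t else (0::real)) has_integral measure lebesgue ({a..b} \<inter> (G - ?A))) UNIV"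
          using m lmeasurable_iff_indicator_has_integral[of "{a..b} \<inter> (G - ?A)"] by metis
      qed
      then show "((\<lambda>t. M * indicator ({a..b} \<inter> (G - ?A)) t) has_integral M * measure lebesgue ({a..b} \<inter> (G - ?A))) {a..b}"
        by (rule has_integral_mult_right)
    qed
    \<comment> \<open>On \<open>?A\<close> the integrand is below \<open>p\<close>; elsewhere in the
      interval, that is on \<open>G - ?A\<close>, it is at most \<open>B\<close>, and the choice of
      \<open>M\<close> ensures B \<le> p + M.\<close>
    have "F b - F a \<le> p * (b - a) + M * measure lebesgue ({a..b} \<inter> (G - ?A))"
    proof (rule has_integral_le[OF F 1])
      fix t assume t: "t \<in> {a..b}"
      show "q t \<le> p + M * indicator ({a..b} \<inter> (G - ?A)) t"
        using B[of t] t ab by (auto simp: indicator_def M_def)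
    qed (use ab in simp)
    then show ?thesis using ab unfolding i I_def by (simp add: algebra_simps)
  qed
  \<comment> \<open>Over disjoint intervals the estimates add up: r - p times the total length is at
    most \<open>M\<close> times the measure of \<open>G - ?A\<close>, hence at most M * \<epsilon> =
    (r - p) * e, which is where \<epsilon> comes from. Finite subfamilies suffice because the bound
    passes to the countable union.\<close>
  have fin: "measure lebesgue (\<Union> (I ` D')) \<le> e" if D': "D' \<subseteq> D" "finite D'" for D'
  proof -
    have dis: "disjoint_family_on I D'" 
      using D(3) D' unfolding disjoint_family_on_def pairwise_def I disjnt_def by blast
    have "(r - p) * measure lebesgue (\<Union> (I ` D')) \<le> (r - p) * (\<Sum>i\<in>D'. measure lebesgue (I i))"
      using \<open>p < r\<close> by (intro mult_left_mono measure_UNION_le that) (auto simp: I_def)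
    also have "\<dots> \<le> (\<Sum>i\<in>D'. M * measure lebesgue (I i \<inter> (G - ?A)))"
      unfolding sum_distrib_left using piece D' by (intro sum_mono) auto
    also have "\<dots> = M * measure lebesgue (\<Union>i\<in>D'. I i \<inter> (G - ?A))"
      unfolding sum_distrib_left[symmetric]
    proof (subst measure_UNION_AE)
      show "finite D'" by fact
      show "\<And>i. i \<in> D' \<Longrightarrow> I i \<inter> (G - ?A) \<in> fmeasurable lebesgue" using G(3) by (auto simp: fmeasurable.Int I_def)
      show "pairwise (\<lambda>i j. AE x in lebesgue. x \<notin> I i \<inter> (G - ?A) \<or> x \<notin> I j \<inter> (G - ?A)) D'"
        using dis by (intro pairwiseI AE_I2) (unfold disjoint_family_on_def, blast)
    qed simp
    also have "\<dots> \<le> M * measure lebesgue (G - ?A)"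
      using \<open>M > 0\<close> G(3) \<open>finite D'\<close>
      by (intro mult_left_mono measure_mono_fmeasurable) (auto simp: I_def intro!: sets.finite_UN sets.Int)
    also have "\<dots> \<le> M * \<epsilon>" using G\<epsilon> \<open>M > 0\<close> by simp
    also have "\<dots> = (r - p) * e" using \<open>M > 0\<close> by (simp add: \<epsilon>_def)
    finally show ?thesis using \<open>p < r\<close> by simp
  qed
  have Vb: "\<Union> (I ` D) \<in> lmeasurable \<and> measure lebesgue (\<Union> (I ` D)) \<le> e"
  proof -
    have "\<And>D'. D' \<subseteq> I ` D \<Longrightarrow> finite D' \<Longrightarrow> measure lebesgue (\<Union> D') \<le> e"
      using fin by (metis finite_subset_image)
    then show ?thesis
      using fmeasurable_Union_bound[of "I ` D" lebesgue e] measure_Union_bound[of "I ` D" lebesgue e] D(1) 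
      by (auto simp: I_def)
  qed
  show "\<exists>T. ?E \<subseteq> T \<and> T \<in> lmeasurable \<and> measure lebesgue T \<le> e"
  proof (intro exI conjI)
    define N where "N = ?E - (\<Union>i \<in> D. I i)"
    have N: "negligible N" using D(4) I unfolding N_def by simp
    show "?E \<subseteq> \<Union> (I ` D) \<union> N" unfolding N_def by blast
    show "\<Union> (I ` D) \<union> N \<in> lmeasurable" using Vb negligible_imp_measurable[OF N] by (auto intro: fmeasurable.Un)
    show "measure lebesgue (\<Union> (I ` D) \<union> N) \<le> e"
    proof -
      have "measure lebesgue (\<Union> (I ` D) \<union> N) = measure lebesgue (\<Union> (I ` D))"
        using measure_Un_null_set[OF fmeasurableD negligible_iff_null_sets[THEN iffD1, OF N]] Vb by blast
      then show ?thesis using Vb by simp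
    qed
  qed
qed

text \<open>If the difference quotients at \<open>t\<close> do not tend to \<open>q t\<close>, then
  arbitrarily short intervals around \<open>t\<close> have a mean of \<open>q\<close> above some
  rational r > p > q t, or the mirror statement holds for -q and -F. The countably many rational
  pairs reduce everything to the Vitali estimate.\<close>

lemma lebesgue_differentiation_bounded:
  fixes q F :: "real \<Rightarrow> real"
  assumes q: "q \<in> borel_measurable lebesgue" and B: "\<And>t. \<bar>q t\<bar> \<le> B"
    and F: "\<And>a b. a \<le> b \<Longrightarrow> (q has_integral (F b - F a)) {a..b}"
  shows "negligible {t. \<not> (F has_real_derivative q t) (at t)}"
proof -
  define E where "E q F i = {t::real. q t < fst i \<and>
           (\<forall>d>0. \<exists>a b. a < b \<and> t \<in> {a..b} \<and> b - a < d \<and> snd i * (b - a) < F b - F a)}"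
    for q F :: "real \<Rightarrow> real" and i :: "real \<times> real"
  define Q where "Q = {(p, r). p \<in> \<rat> \<and> r \<in> \<rat> \<and> p < (r::real)}"
  have "Q \<subseteq> \<rat> \<times> \<rat>" by (auto simp: Q_def)
  then have "countable Q" using countable_rat countable_SIGMA[of \<rat> "\<lambda>_. \<rat>"] countable_subset by blast
  have m: "(\<lambda>t. - q t) \<in> borel_measurable lebesgue" using q by simp
  have neg1: "negligible (E q F i)" if "i \<in> Q" for i
    using that negligible_vitali_upper_derivate[OF q B F] by (auto simp: Q_def E_def)
  have neg2: "negligible (E (\<lambda>t. - q t) (\<lambda>t. - F t) i)" if "i \<in> Q" for i
  proof -
    have "((\<lambda>t. - q t) has_integral (- F b - - F a)) {a..b}" if "a \<le> b" for a b
      using has_integral_neg[OF F[OF that]] by simp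
    then show ?thesis
      using that negligible_vitali_upper_derivate[OF m, of B "\<lambda>t. - F t"] B by (auto simp: Q_def E_def)
  qed
  have neg: "negligible (\<Union>i\<in>Q. E q F i \<union> E (\<lambda>t. - q t) (\<lambda>t. - F t) i)"
    using neg1 neg2 \<open>countable Q\<close> by (intro negligible_countable_Union) (auto intro: negligible_Un)
  \<comment> \<open>Two rationals are inserted between \<open>q t\<close> and q t + \<epsilon>: the
    exceptional set compares \<open>q t\<close> with one and the quotients with the other. Stated
    for arbitrary \<open>q\<close> and \<open>F\<close> so that it also serves their
    negatives.\<close>
  have key: "\<exists>d>0. \<forall>a b. a < b \<longrightarrow> t \<in> {a..b} \<longrightarrow> b - a < d \<longrightarrow> F b - F a \<le> (q t + \<epsilon>) * (b - a)"
    if "t \<notin> (\<Union>i\<in>Q. E q F i)" and "\<epsilon> > 0" for t \<epsilon> and q F :: "real \<Rightarrow> real"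
  proof -
    obtain p where p: "p \<in> \<rat>" "q t < p" "p < q t + \<epsilon>/2" using Rats_dense_in_real[of "q t" "q t + \<epsilon>/2"] \<open>\<epsilon> > 0\<close> by auto
    obtain r where r: "r \<in> \<rat>" "p < r" "r < q t + \<epsilon>" using Rats_dense_in_real[of p "q t + \<epsilon>"] p \<open>\<epsilon> > 0\<close> by auto
    have "(p, r) \<in> Q" using p r by (auto simp: Q_def)
    with that have "t \<notin> E q F (p, r)" by blast
    then obtain d where d: "d > 0" "\<And>a b. a < b \<Longrightarrow> t \<in> {a..b} \<Longrightarrow> b - a < d \<Longrightarrow> F b - F a \<le> r * (b - a)"
      using p unfolding E_def by (simp add: not_less) (metis linorder_not_le)
    have "F b - F a \<le> (q t + \<epsilon>) * (b - a)" if "a < b" "t \<in> {a..b}" "b - a < d" for a b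
      using d(2)[OF that] mult_right_mono[of r "q t + \<epsilon>" "b - a"] r that by linarith
    then show ?thesis using d by blast
  qed
  show ?thesis
  proof (rule negligible_subset[OF neg], rule subsetI, rule ccontr)
    fix t assume t: "t \<in> {t. \<not> (F has_real_derivative q t) (at t)}"
      and nt: "t \<notin> (\<Union>i\<in>Q. E q F i \<union> E (\<lambda>t. - q t) (\<lambda>t. - F t) i)"
    have "(F has_real_derivative q t) (at t)"
      unfolding has_field_derivative_def has_derivative_at_alt
    proof (intro conjI allI impI)
      show "bounded_linear ((*) (q t))" by (rule bounded_linear_mult_right)
      fix \<epsilon> :: real assume "\<epsilon> > 0"
      obtain d1 where d1: "d1 > 0" "\<And>a b. a < b \<Longrightarrow> t \<in> {a..b} \<Longrightarrow> b - a < d1 \<Longrightarrow> F b - F a \<le> (q t + \<epsilon>) * (b - a)"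
        using key[of t q F \<epsilon>] nt \<open>\<epsilon> > 0\<close> by auto
      obtain d2 where d2: "d2 > 0" "\<And>a b. a < b \<Longrightarrow> t \<in> {a..b} \<Longrightarrow> b - a < d2 \<Longrightarrow> - F b - - F a \<le> (- q t + \<epsilon>) * (b - a)"
        using key[of t "\<lambda>t. - q t" "\<lambda>t. - F t" \<epsilon>] nt \<open>\<epsilon> > 0\<close> by auto
      have "norm (F y - F t - q t * (y - t)) \<le> \<epsilon> * norm (y - t)" if y: "norm (y - t) < min d1 d2" for y
      proof -
        consider "y = t" | "t < y" | "y < t" by linarith
        then show ?thesis
        proof cases
          case 2
          then show ?thesis using d1(2)[of t y] d2(2)[of t y] y by (auto simp: algebra_simps abs_le_iff)
        next
          case 3
          then show ?thesis using d1(2)[of y t] d2(2)[of y t] y by (auto simp: algebra_simps abs_le_iff)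
        qed simp
      qed
      then show "\<exists>d>0. \<forall>y. norm (y - t) < d \<longrightarrow> norm (F y - F t - q t * (y - t)) \<le> \<epsilon> * norm (y - t)"
        using d1(1) d2(1) by (intro exI[of _ "min d1 d2"]) auto
    qed
    then show False using t by blast
  qed
qed

section \<open>KL functions with prescribed dyadic descent times\<close>

text \<open>\<open>A\<close> adds one clipped ramp of height \<open>a n\<close> over each interval
  from n to n + 1, a piecewise linear staircase whose increments can be prescribed.\<close>

lemma ex_continuous_mono_increments_nat:
  fixes a :: "nat \<Rightarrow> real"
  assumes a: "\<And>n. 0 \<le> a n"
  obtains A :: "real \<Rightarrow> real" where "continuous_on UNIV A" "mono A"
    "\<And>x. x \<le> 0 \<Longrightarrow> A x = 0" "\<And>n. a n \<le> A (real n + 1) - A (real n)"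
proof -
  define c :: "real \<Rightarrow> real" where "c x = min 1 (max 0 x)" for x
  define A where "A x = (\<Sum>n<nat \<lceil>x\<rceil>. a n * c (x - real n))" for x
  \<comment> \<open>Ramps that start at or beyond \<open>x\<close> vanish there, so any longer sum
    has the same value; on each half-line bounded above \<open>A\<close> is thus one fixed finite
    sum.\<close>
  have A_eq: "A x = (\<Sum>n<N. a n * c (x - real n))" if "x \<le> real N" for x N
    unfolding A_def
  proof (rule sum.mono_neutral_left)
    show "{..<nat \<lceil>x\<rceil>} \<subseteq> {..<N}" using that by (auto simp: ceiling_le_iff nat_le_iff)
    show "\<forall>i\<in>{..<N} - {..<nat \<lceil>x\<rceil>}. a i * c (x - real i) = 0"
      by (auto simp: c_def nat_le_iff ceiling_le_iff)
  qed simp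
  have c_mono: "c x \<le> c y" if "x \<le> y" for x y using that by (auto simp: c_def)
  have c_cont: "continuous_on S c" for S unfolding c_def by (intro continuous_intros)
  show thesis
  proof
    show "continuous_on UNIV A"
    proof (rule continuous_at_imp_continuous_on, rule ballI)
      fix x :: real
      obtain N where N: "x < real N" using reals_Archimedean2 by blast
      have "continuous_on {..<real N} (\<lambda>x. \<Sum>n<N. a n * c (x - real n))"
        by (intro continuous_intros continuous_on_compose2[OF c_cont[of UNIV]]) auto
      then have "continuous_on {..<real N} A"
        using A_eq[of _ N] by (subst continuous_on_cong[OF refl]) auto
      then show "isCont A x" using N continuous_on_eq_continuous_at[of "{..<real N}" A] by auto
    qed
    show "mono A"
    proof (rule monoI)
      fix x y :: real assume "x \<le> y"
      obtain N where N: "y < real N" using reals_Archimedean2 by blast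
      show "A x \<le> A y"
        unfolding A_eq[OF order_trans[OF \<open>x \<le> y\<close> less_imp_le[OF N]]] A_eq[OF less_imp_le[OF N]]
        using \<open>x \<le> y\<close> a by (intro sum_mono mult_left_mono c_mono) auto
    qed
    show "A x = 0" if "x \<le> 0" for x using A_eq[of x 0] that by simp
    show "a n \<le> A (real n + 1) - A (real n)" for n
    proof -
      have "A (real n + 1) = (\<Sum>i<n. a i * c (real n + 1 - real i)) + a n"
        using A_eq[of "real n + 1" "Suc n"] by (simp add: c_def)
      moreover have "A (real n) = (\<Sum>i<n. a i * c (real n - real i))" using A_eq[of "real n" n] by simp
      moreover have "(\<Sum>i<n. a i * c (real n - real i)) \<le> (\<Sum>i<n. a i * c (real n + 1 - real i))"
        using a by (intro sum_mono mult_left_mono c_mono) auto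
      ultimately show ?thesis by linarith
    qed
  qed
qed

text \<open>\<open>P\<close> stretches the logarithmic scale so that crossing level \<open>m\<close>
  takes at least \<Theta> m, whatever the sign or growth of \<Theta>. One staircase serves the
  levels m \<ge> 1, a reflected one the levels m \<le> 0; the summand \<open>x\<close> gives
  strictness and surjectivity.\<close>

lemma ex_homeomorphism_increments_int:
  fixes \<Theta> :: "int \<Rightarrow> real"
  obtains P :: "real \<Rightarrow> real" where "continuous_on UNIV P" "strict_mono P" "surj P"
    "\<And>m. \<Theta> m \<le> P (of_int m) - P (of_int m - 1)"
proof -
  obtain A where A: "continuous_on UNIV A" "mono A" "\<And>x. x \<le> 0 \<Longrightarrow> A x = 0"
    "\<And>n. max 0 (\<Theta> (int n + 1)) \<le> A (real n + 1) - A (real n)"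
    using ex_continuous_mono_increments_nat[of "\<lambda>n. max 0 (\<Theta> (int n + 1))"] by auto
  obtain B where B: "continuous_on UNIV B" "mono B" "\<And>x. x \<le> 0 \<Longrightarrow> B x = 0"
    "\<And>n. max 0 (\<Theta> (- int n)) \<le> B (real n + 1) - B (real n)"
    using ex_continuous_mono_increments_nat[of "\<lambda>n. max 0 (\<Theta> (- int n))"] by auto
  define P where "P x = x + A x - B (- x)" for x
  have cont: "continuous_on UNIV P" unfolding P_def
    by (intro continuous_intros A B continuous_on_compose2[OF B(1)]) auto
  show thesis
  proof
    show "continuous_on UNIV P" by (rule cont)
    show "strict_mono P"
    proof (rule strict_monoI)
      fix x y :: real assume "x < y"
      then show "P x < P y" using monoD[OF A(2), of x y] monoD[OF B(2), of "- y" "- x"] by (simp add: P_def)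
    qed
    have "\<exists>x. P x = y" for y
    proof -
      define r where "r = \<bar>y\<bar>"
      have "r \<le> P r" using monoD[OF A(2), of 0 r] A(3)[of 0] B(3)[of "- r"] by (simp add: P_def r_def)
      moreover have "P (- r) \<le> - r" using monoD[OF B(2), of 0 r] B(3)[of 0] A(3)[of "- r"] by (simp add: P_def r_def)
      moreover have "- r \<le> y" "y \<le> r" "- r \<le> r" by (auto simp: r_def)
      moreover have "continuous_on {- r..r} P" using cont continuous_on_subset by blast
      ultimately show ?thesis using IVT'[of P "- r" y r] by auto
    qed
    then show "surj P" by (metis surjI)
    show "\<Theta> m \<le> P (of_int m) - P (of_int m - 1)" for m
    proof (cases "m \<ge> 1")
      case True
      then have n: "int (nat (m - 1)) = m - 1" "real (nat (m - 1)) = of_int m - 1" by auto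
      show ?thesis using A(4)[of "nat (m - 1)"] B(3)[of "- of_int m"] B(3)[of "- of_int m + 1"] True
        unfolding n by (simp add: P_def)
    next
      case False
      then have n: "int (nat (- m)) = - m" "real (nat (- m)) = - of_int m" by auto
      show ?thesis using B(4)[of "nat (- m)"] A(3)[of "of_int m"] A(3)[of "of_int m - 1"] False
        unfolding n by (simp add: P_def)
    qed
  qed
qed

text \<open>In the application \<Theta> (k - i) bounds the stay in level k - i, starting from level
  \<open>k\<close>. As long as \<open>s\<close> does not exceed the total allowed for the levels k,
  ..., k - j, the trajectory may still be in level k - j, where the only bound on the distance is
  \<alpha> of the upper end 2^(k-j+1).\<close>

lemma ex_class_KL_dyadic:
  fixes \<alpha> :: "real \<Rightarrow> real" and \<Theta> :: "int \<Rightarrow> real"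
  assumes \<alpha>_cont: "continuous_on {0..} \<alpha>" and \<alpha>_mono: "strict_mono_on {0..} \<alpha>"
    and \<alpha>_0: "\<alpha> 0 = 0" and \<alpha>_unb: "\<not> bdd_above (\<alpha> ` {0..})"
  obtains \<beta> where "class_KL \<beta>"
    "\<And>k j R s. 2 powr of_int k < R \<Longrightarrow> 0 \<le> s \<Longrightarrow> s \<le> (\<Sum>i\<le>j. \<Theta> (k - int i)) \<Longrightarrow>
       \<alpha> (2 powr (of_int k - real j + 1)) \<le> \<beta> R s"
proof -
  obtain P :: "real \<Rightarrow> real" where P: "continuous_on UNIV P" "strict_mono P" "surj P"
    "\<And>m. \<Theta> m \<le> P (of_int m) - P (of_int m - 1)"
    by (rule ex_homeomorphism_increments_int[of \<Theta>]) (rule that)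
  define Q where "Q = inv P"
  have inj: "inj P" using P(2) by (simp add: strict_mono_imp_inj_on)
  have QP[simp]: "Q (P x) = x" for x using inj by (simp add: Q_def)
  have PQ[simp]: "P (Q x) = x" for x using P(3) by (simp add: Q_def surj_f_inv_f)
  have Q_less[simp]: "Q x < Q y \<longleftrightarrow> x < y" for x y
    using strict_mono_less[OF P(2), of "Q x" "Q y"] by simp
  have Q_cont: "continuous_on UNIV Q"
  proof (rule continuous_at_imp_continuous_on, rule ballI)
    fix y
    have "isCont P z" for z using P(1) by (simp add: continuous_on_eq_continuous_at)
    then have "isCont Q (P (Q y))"
      by (intro isCont_inverse_function[of 1 "Q y" Q P]) simp_all
    then show "isCont Q y" by simp
  qed
  \<comment> \<open>On the scale \<open>P (log 2 R)\<close> a level is left at unit speed, and one dyadic step takes at least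
    \<open>\<Theta>\<close>. The factor 4 makes up for the rounding of \<open>R\<close> and of \<open>s\<close> to whole dyadic steps.\<close>
  define \<phi> where "\<phi> R s = 4 * 2 powr (Q (P (log 2 R) - s))" for R s
  define \<beta> where "\<beta> R s = (if R \<le> 0 then 0 else \<alpha> (\<phi> R s))" for R s
  have \<alpha>_less: "\<alpha> x < \<alpha> y" if "0 \<le> x" "x < y" for x y
    using that \<alpha>_mono by (auto simp: strict_mono_on_def)
  have \<alpha>_le: "\<alpha> x \<le> \<alpha> y" if "0 \<le> x" "x \<le> y" for x y
    using \<alpha>_less[of x y] that by (cases "x = y") auto
  have \<alpha>_nn: "0 \<le> \<alpha> x" if "0 \<le> x" for x using \<alpha>_le[of 0 x] that \<alpha>_0 by simp
  have \<phi>_pos: "0 < \<phi> R s" for R s by (simp add: \<phi>_def)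
  have \<phi>_le: "\<phi> R s \<le> 4 * R" if "R > 0" "s \<ge> 0" for R s
  proof -
    have "Q (P (log 2 R) - s) \<le> log 2 R" using Q_less[of "P (log 2 R)" "P (log 2 R) - s"] that
      by (simp add: not_less[symmetric] del: Q_less) 
    then have "2 powr (Q (P (log 2 R) - s)) \<le> 2 powr (log 2 R)" by simp
    then show ?thesis using that by (simp add: \<phi>_def)
  qed
  have \<phi>_less1: "\<phi> R s < \<phi> R' s" if "0 < R" "R < R'" for R R' s
    using that P(2) by (simp add: \<phi>_def strict_mono_less)
  have \<phi>_less2: "\<phi> R s' < \<phi> R s" if "s < s'" for R s s'
    using that by (simp add: \<phi>_def)
  have \<phi>_cont: "continuous_on ({0<..} \<times> {0..}) (\<lambda>(R, s). \<phi> R s)"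
    unfolding \<phi>_def split_beta
    by (intro continuous_intros continuous_on_compose2[OF Q_cont] continuous_on_compose2[OF P(1)]) auto
  have \<beta>_le: "\<beta> R s \<le> \<alpha> (4 * R)" if "R \<ge> 0" "s \<ge> 0" for R s
    using that \<alpha>_le[OF less_imp_le[OF \<phi>_pos] \<phi>_le] \<alpha>_0 by (auto simp: \<beta>_def)
  have \<beta>_nn: "0 \<le> \<beta> R s" for R s using \<alpha>_nn \<phi>_pos by (auto simp: \<beta>_def less_imp_le)
  \<comment> \<open>The formula with \<open>log 2 R\<close> gives no continuity at R = 0; there
    \<beta> is squeezed between 0 and \<alpha> (4 * R).\<close>
  have \<beta>_cont: "continuous_on ({0..} \<times> {0..}) (\<lambda>(R, s). \<beta> R s)"
    unfolding continuous_on_def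
  proof (rule ballI)
    fix p :: "real \<times> real" assume p: "p \<in> {0..} \<times> {0..}"
    show "((\<lambda>(R, s). \<beta> R s) \<longlongrightarrow> (case p of (R, s) \<Rightarrow> \<beta> R s)) (at p within {0..} \<times> {0..})"
    proof (cases "fst p > 0")
      case True
      have eq: "at p within {0..} \<times> {0..} = at p within {0<..} \<times> {0..}"
        by (rule at_within_nhd[of _ "{0<..} \<times> UNIV"]) (use True in \<open>auto simp: open_Times mem_Times_iff\<close>)
      have "continuous_on ({0<..} \<times> {0..}) (\<lambda>p. \<alpha> (case p of (R, s) \<Rightarrow> \<phi> R s))"
        by (rule continuous_on_compose2[OF \<alpha>_cont \<phi>_cont]) (auto simp: \<phi>_pos less_imp_le)
      then have "continuous_on ({0<..} \<times> {0..}) (\<lambda>(R, s). \<beta> R s)"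
        by (subst continuous_on_cong[OF refl]) (auto simp: \<beta>_def)
      then show ?thesis unfolding eq continuous_on_def
        by (rule bspec) (use p True in \<open>simp add: mem_Times_iff\<close>)
    next
      case False
      then have 0: "(case p of (R, s) \<Rightarrow> \<beta> R s) = 0" "fst p = 0" using p by (auto simp: \<beta>_def split_beta)
      have "continuous_on ({0..} \<times> {0..}) (\<lambda>p::real\<times>real. \<alpha> (4 * fst p))"
        by (rule continuous_on_compose2[OF \<alpha>_cont]) (auto intro!: continuous_intros)
      then have lim: "((\<lambda>p. \<alpha> (4 * fst p)) \<longlongrightarrow> 0) (at p within {0..} \<times> {0..})"
        unfolding continuous_on_def using p 0(2) \<alpha>_0 by (metis mult_zero_right)
      show ?thesis unfolding 0
      proof (rule tendsto_sandwich[OF _ _ tendsto_const lim])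
        show "\<forall>\<^sub>F n in at p within {0..} \<times> {0..}. 0 \<le> (case n of (R, s) \<Rightarrow> \<beta> R s)"
          using \<beta>_nn by (intro always_eventually) auto
        show "\<forall>\<^sub>F n in at p within {0..} \<times> {0..}. (case n of (R, s) \<Rightarrow> \<beta> R s) \<le> \<alpha> (4 * fst n)"
          unfolding eventually_at_filter using \<beta>_le by (intro always_eventually) auto
      qed
    qed
  qed
  have KL: "class_KL \<beta>"
    unfolding class_KL_def
  proof (intro conjI allI impI)
    show "continuous_on ({0..} \<times> {0..}) (\<lambda>(r, t). \<beta> r t)" by (rule \<beta>_cont)
    fix t :: real assume "t \<ge> 0"
    show "\<beta> 0 t = 0" by (simp add: \<beta>_def)
    show "strict_mono_on {0..} (\<lambda>r. \<beta> r t)"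
    proof (rule strict_mono_onI)
      fix r s :: real assume "r \<in> {0..}" "s \<in> {0..}" "r < s"
      then show "\<beta> r t < \<beta> s t"
        using \<alpha>_less[OF less_imp_le[OF \<phi>_pos] \<phi>_less1[of r s t]] \<alpha>_less[OF order_refl \<phi>_pos[of s t]] \<alpha>_0
        by (auto simp: \<beta>_def)
    qed
    show "\<not> bdd_above ((\<lambda>r. \<beta> r t) ` {0..})"
    proof
      assume "bdd_above ((\<lambda>r. \<beta> r t) ` {0..})"
      then obtain M where M: "\<And>r. r \<ge> 0 \<Longrightarrow> \<beta> r t \<le> M" by (auto simp: bdd_above_def)
      have "\<alpha> x \<le> max M (\<alpha> 0)" if "x \<ge> 0" for x
      proof (cases "x = 0")
        case False
        then have "x > 0" using that by simp
        \<comment> \<open>Solves \<phi> r t = x: start from x / 4 on the scale of \<open>P\<close>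
          and go back by time \<open>t\<close>.\<close>
        define r where "r = 2 powr (Q (P (log 2 (x / 4)) + t))"
        have "\<phi> r t = x" using \<open>x > 0\<close> by (simp add: r_def \<phi>_def)
        moreover have "r > 0" by (simp add: r_def)
        ultimately have "\<beta> r t = \<alpha> x" by (simp add: \<beta>_def)
        then show ?thesis using M[of r] \<open>r > 0\<close> by simp
      qed simp
      then show False using \<alpha>_unb by (auto simp: bdd_above_def)
    qed
  next
    fix r :: real assume "r > 0"
    show "strict_antimono_on {0..} (\<beta> r)"
      using \<alpha>_less[OF less_imp_le[OF \<phi>_pos] \<phi>_less2] \<open>r > 0\<close>
      by (auto simp: monotone_on_def \<beta>_def)
  next
    fix r :: real assume "r \<ge> 0"
    show "(\<beta> r \<longlongrightarrow> 0) at_top"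
    proof (cases "r = 0")
      case False
      show ?thesis
      proof (rule order_tendstoI)
        fix a :: real assume "a < 0"
        then show "\<forall>\<^sub>F s in at_top. a < \<beta> r s" using \<beta>_nn by (intro always_eventually) (auto intro: less_le_trans)
      next
        fix e :: real assume "e > 0"
        have "(\<alpha> \<longlongrightarrow> 0) (at 0 within {0..})" using \<alpha>_cont \<alpha>_0 unfolding continuous_on_def by (metis atLeast_iff order_refl)
        then have "\<forall>\<^sub>F x in at 0 within {0..}. \<alpha> x < e" using \<open>e > 0\<close> order_tendstoD by blast
        then obtain d where d: "d > 0" "\<And>x. 0 < x \<Longrightarrow> x < d \<Longrightarrow> \<alpha> x < e"
          unfolding eventually_at by (auto simp: dist_real_def)
        have "\<beta> r s < e" if "s > P (log 2 r) - P (log 2 (d / 4))" for s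
        proof -
          have "Q (P (log 2 r) - s) < Q (P (log 2 (d / 4)))" using that by (simp del: QP)
          then have "2 powr (Q (P (log 2 r) - s)) < 2 powr (log 2 (d / 4))" by simp
          then have "\<phi> r s < d" using \<open>d > 0\<close> by (simp add: \<phi>_def)
          then show ?thesis using d \<phi>_pos False \<open>r \<ge> 0\<close> by (simp add: \<beta>_def)
        qed
        then show "\<forall>\<^sub>F s in at_top. \<beta> r s < e"
          by (rule eventually_mono[OF eventually_gt_at_top])
      qed
    next
      case True
      then show ?thesis by (simp add: \<beta>_def[abs_def])
    qed
  qed (use \<beta>_nn in auto)
  show thesis
  proof (rule that[OF KL])
    fix k :: int and j :: nat and R s :: real
    assume k: "2 powr of_int k < R" and s: "0 \<le> s" "s \<le> (\<Sum>i\<le>j. \<Theta> (k - int i))"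
    have "R > 0" using k powr_gt_zero[of 2 "of_int k"] by linarith
    \<comment> \<open>The increments of \<open>P\<close> telescope, so within the time allowed for
      the levels k to k - j the position falls at most from k to k - j - 1; the factor 4 then turns
      2^(k-j-1) into 2^(k-j+1).\<close>
    have "(\<Sum>i\<le>j. \<Theta> (k - int i)) \<le> P (of_int k) - P (of_int k - real j - 1)" for j
    proof (induction j)
      case 0
      then show ?case using P(4)[of k] by simp
    next
      case (Suc j)
      then show ?case using P(4)[of "k - int (Suc j)"] by (simp add: algebra_simps)
    qed
    then have "P (of_int k - real j - 1) \<le> P (of_int k) - s" using s by (smt (verit))
    also have "P (of_int k) < P (log 2 R)"
      using P(2) k \<open>R > 0\<close> by (simp add: strict_mono_less less_log_iff)
    finally have "P (of_int k - real j - 1) < P (log 2 R) - s" by simp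
    then have "of_int k - real j - 1 < Q (P (log 2 R) - s)" using Q_less[of "P (of_int k - real j - 1)"] by (simp del: Q_less)
    then have "2 powr (of_int k - real j - 1) < 2 powr Q (P (log 2 R) - s)" by simp
    then have "2 powr (of_int k - real j + 1) \<le> \<phi> R s"
      by (simp add: \<phi>_def powr_add powr_diff field_simps)
    then show "\<alpha> (2 powr (of_int k - real j + 1)) \<le> \<beta> R s"
      using \<open>R > 0\<close> by (auto simp: \<beta>_def intro: \<alpha>_le)
  qed
qed

section \<open>Absolute continuity and bi-Lipschitz time changes\<close>

text \<open>The clock is built on the whole line, so that its inverse is global and no end points
  need care later; it inherits its slope bounds from \<open>q\<close>.\<close>

lemma ex_bilipschitz_primitive:
  fixes q :: "real \<Rightarrow> real"
  assumes q: "q \<in> borel_measurable lebesgue" and "0 < lo" and bd: "\<And>t. lo \<le> q t \<and> q t \<le> hi"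
  obtains F where "F 0 = 0" "\<And>a b. a \<le> b \<Longrightarrow> lo * (b - a) \<le> F b - F a \<and> F b - F a \<le> hi * (b - a)"
    "negligible {t. \<not> (F has_real_derivative q t) (at t)}"
proof -
  have int: "q integrable_on {a..b}" for a b
  proof (rule measurable_bounded_by_integrable_imp_integrable)
    show "q \<in> borel_measurable (lebesgue_on {a..b})" using q measurable_restrict_space1 by blast
    show "(\<lambda>_. hi) integrable_on {a..b}" by (rule integrable_const_ivl)
    show "norm (q x) \<le> hi" for x using bd[of x] \<open>0 < lo\<close> by simp
  qed simp
  \<comment> \<open>A signed integral: at most one of the two intervals is nondegenerate.\<close>
  define F where "F t = integral {0..t} q - integral {t..0} q" for t
  have F: "(q has_integral (F b - F a)) {a..b}" if "a \<le> b" for a b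
  proof -
    have "F b - F a = integral {a..b} q"
    proof -
      consider "0 \<le> a" | "a \<le> 0" "0 \<le> b" | "b \<le> 0" by linarith
      then show ?thesis
      proof cases
        case 1
        then have e: "integral {a..0} q = 0" "integral {b..0} q = 0" using that by (cases "a = 0"; cases "b = 0"; auto)+
        show ?thesis using Henstock_Kurzweil_Integration.integral_combine[OF 1 that int] by (simp add: F_def e)
      next
        case 2
        then have e: "integral {0..a} q = 0" "integral {b..0} q = 0" using that by (cases "a = 0"; cases "b = 0"; auto)+
        show ?thesis using Henstock_Kurzweil_Integration.integral_combine[OF 2 int] by (simp add: F_def e)
      next
        case 3
        then have e: "integral {0..a} q = 0" "integral {0..b} q = 0" using that by (cases "a = 0"; cases "b = 0"; auto)+
        show ?thesis using Henstock_Kurzweil_Integration.integral_combine[OF that 3 int] by (simp add: F_def e)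
      qed
    qed
    then show ?thesis using int by (simp add: has_integral_integral)
  qed
  show thesis
  proof
    show "F 0 = 0" by (simp add: F_def)
    show "lo * (b - a) \<le> F b - F a \<and> F b - F a \<le> hi * (b - a)" if "a \<le> b" for a b
    proof
      have c: "((\<lambda>_. k) has_integral k * (b - a)) {a..b}" for k :: real
        using has_integral_const_real[of k a b] that by (simp add: mult.commute)
      show "lo * (b - a) \<le> F b - F a" by (rule has_integral_le[OF c F[OF that]]) (use bd in auto)
      show "F b - F a \<le> hi * (b - a)" by (rule has_integral_le[OF F[OF that] c]) (use bd in auto)
    qed
    have "\<bar>q t\<bar> \<le> hi" for t using bd[of t] \<open>0 < lo\<close> by simp
    then show "negligible {t. \<not> (F has_real_derivative q t) (at t)}"
      by (rule lebesgue_differentiation_bounded[OF q _ F])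
  qed
qed

lemma abs_continuous_onE:
  assumes "abs_continuous_on S x" and "e > 0"
  obtains d where "d > 0"
    "\<And>(N::nat) a b. (\<forall>i<N. a i \<le> b i \<and> {a i..b i} \<subseteq> S) \<Longrightarrow>
        disjoint_family_on (\<lambda>i. {a i<..<b i}) {..<N} \<Longrightarrow>
        (\<Sum>i<N. b i - a i) < d \<Longrightarrow> (\<Sum>i<N. norm (x (b i) - x (a i))) < e"
proof -
  have "\<exists>d>0. \<forall>(N::nat) a b.
        (\<forall>i<N. a i \<le> b i \<and> {a i..b i} \<subseteq> S) \<longrightarrow>
        disjoint_family_on (\<lambda>i. {a i<..<b i}) {..<N} \<longrightarrow>
        (\<Sum>i<N. b i - a i) < d \<longrightarrow>
        (\<Sum>i<N. norm (x (b i) - x (a i))) < e"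
    by (rule assms(1)[unfolded abs_continuous_on_def, THEN spec[of _ e], THEN mp, OF assms(2)])
  then obtain d where "d > 0" and d: "\<forall>(N::nat) a b.
        (\<forall>i<N. a i \<le> b i \<and> {a i..b i} \<subseteq> S) \<longrightarrow>
        disjoint_family_on (\<lambda>i. {a i<..<b i}) {..<N} \<longrightarrow>
        (\<Sum>i<N. b i - a i) < d \<longrightarrow>
        (\<Sum>i<N. norm (x (b i) - x (a i))) < e"
    by (elim exE conjE) (rule that)
  show thesis
    by (rule that[OF \<open>d > 0\<close>], rule d[THEN spec, THEN spec, THEN spec, THEN mp, THEN mp, THEN mp])
qed

lemma abs_continuous_on_imp_continuous_on:
  assumes "abs_continuous_on {a..b} x"
  shows "continuous_on {a..b} x"
  unfolding continuous_on_iff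
proof (intro ballI allI impI)
  fix s e :: real assume s: "s \<in> {a..b}" and "e > 0"
  obtain d where d: "d > 0" "\<And>(N::nat) a' b'. (\<forall>i<N. a' i \<le> b' i \<and> {a' i..b' i} \<subseteq> {a..b}) \<Longrightarrow>
        disjoint_family_on (\<lambda>i. {a' i<..<b' i}) {..<N} \<Longrightarrow>
        (\<Sum>i<N. b' i - a' i) < d \<Longrightarrow> (\<Sum>i<N. norm (x (b' i) - x (a' i))) < e"
    by (rule abs_continuous_onE[OF assms \<open>e > 0\<close>]) (rule that)
  have "dist (x t) (x s) < e" if "t \<in> {a..b}" "dist t s < d" for t
    using d(2)[of "Suc 0" "\<lambda>_. min s t" "\<lambda>_. max s t"] s that
    by (cases "s \<le> t") (auto simp: disjoint_family_on_def dist_norm norm_minus_commute)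
  then show "\<exists>d>0. \<forall>t\<in>{a..b}. dist t s < d \<longrightarrow> dist (x t) (x s) < e" using d(1) by blast
qed

lemma abs_continuous_on_subset:
  assumes "abs_continuous_on S x" "T \<subseteq> S"
  shows "abs_continuous_on T x"
  using assms unfolding abs_continuous_on_def by (meson order_trans)

lemma abs_continuous_on_cong:
  assumes "\<And>t. t \<in> S \<Longrightarrow> x t = y t"
  shows "abs_continuous_on S x \<longleftrightarrow> abs_continuous_on S y"
proof -
  have "(\<Sum>i<N. norm (x (b i) - x (a i))) = (\<Sum>i<N. norm (y (b i) - y (a i)))"
    if "\<forall>i<N. a i \<le> b i \<and> {a i..b i} \<subseteq> S" for N :: nat and a b
    using that by (intro sum.cong refl) (simp add: assms subset_iff)
  then show ?thesis unfolding abs_continuous_on_def by (simp cong: conj_cong imp_cong)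
qed

text \<open>Each interval is cut at \<open>c\<close> by clipping its end points with
  \<open>min\<close> and \<open>max\<close>; an interval on one side of \<open>c\<close> leaves a
  degenerate remnant on the other, and the triangle inequality joins the two sums. If
  \<open>c\<close> lies outside, one of the clipped sums is zero.\<close>

lemma abs_continuous_on_join:
  fixes x :: "real \<Rightarrow> 'a::real_normed_vector"
  assumes "abs_continuous_on {a..c} x" "abs_continuous_on {c..b} x"
  shows "abs_continuous_on {a..b} x"
  unfolding abs_continuous_on_def
proof (intro allI impI)
  fix e :: real assume "e > 0"
  then have "e / 2 > 0" by simp
  obtain d1 where d1: "d1 > 0" "\<And>(N::nat) a' b'. (\<forall>i<N. a' i \<le> b' i \<and> {a' i..b' i} \<subseteq> {a..c}) \<Longrightarrow>
        disjoint_family_on (\<lambda>i. {a' i<..<b' i}) {..<N} \<Longrightarrow>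
        (\<Sum>i<N. b' i - a' i) < d1 \<Longrightarrow> (\<Sum>i<N. norm (x (b' i) - x (a' i))) < e / 2"
    by (rule abs_continuous_onE[OF assms(1) \<open>e / 2 > 0\<close>]) (rule that)
  obtain d2 where d2: "d2 > 0" "\<And>(N::nat) a' b'. (\<forall>i<N. a' i \<le> b' i \<and> {a' i..b' i} \<subseteq> {c..b}) \<Longrightarrow>
        disjoint_family_on (\<lambda>i. {a' i<..<b' i}) {..<N} \<Longrightarrow>
        (\<Sum>i<N. b' i - a' i) < d2 \<Longrightarrow> (\<Sum>i<N. norm (x (b' i) - x (a' i))) < e / 2"
    by (rule abs_continuous_onE[OF assms(2) \<open>e / 2 > 0\<close>]) (rule that)
  show "\<exists>d>0. \<forall>(N::nat) l r. (\<forall>i<N. l i \<le> r i \<and> {l i..r i} \<subseteq> {a..b}) \<longrightarrow>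
        disjoint_family_on (\<lambda>i. {l i<..<r i}) {..<N} \<longrightarrow>
        (\<Sum>i<N. r i - l i) < d \<longrightarrow> (\<Sum>i<N. norm (x (r i) - x (l i))) < e"
  proof (intro exI conjI allI impI)
    show "min d1 d2 > 0" using d1 d2 by simp
    fix N :: nat and l r
    assume lr: "\<forall>i<N. l i \<le> r i \<and> {l i..r i} \<subseteq> {a..b}"
      and dis: "disjoint_family_on (\<lambda>i. {l i<..<r i}) {..<N}"
      and len: "(\<Sum>i<N. r i - l i) < min d1 d2"
    have "(\<Sum>i<N. norm (x (min (r i) c) - x (min (l i) c))) < e / 2"
    proof (cases "a \<le> c")
      case True
      show ?thesis
      proof (rule d1(2))
        show "\<forall>i<N. min (l i) c \<le> min (r i) c \<and> {min (l i) c..min (r i) c} \<subseteq> {a..c}" using lr True by fastforce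
        show "disjoint_family_on (\<lambda>i. {min (l i) c<..<min (r i) c}) {..<N}"
          by (rule disjoint_family_on_bisimulation[OF dis]) auto
        have "(\<Sum>i<N. min (r i) c - min (l i) c) \<le> (\<Sum>i<N. r i - l i)" using lr by (intro sum_mono) (auto simp: min_def)
        then show "(\<Sum>i<N. min (r i) c - min (l i) c) < d1" using len by linarith
      qed
    next
      case False
      then have "(\<Sum>i<N. norm (x (min (r i) c) - x (min (l i) c))) = 0"
        using lr by (intro sum.neutral) (auto simp: min_def)
      then show ?thesis using \<open>e / 2 > 0\<close> by simp
    qed
    moreover have "(\<Sum>i<N. norm (x (max (r i) c) - x (max (l i) c))) < e / 2"
    proof (cases "c \<le> b")
      case True
      show ?thesis
      proof (rule d2(2))
        show "\<forall>i<N. max (l i) c \<le> max (r i) c \<and> {max (l i) c..max (r i) c} \<subseteq> {c..b}" using lr True by fastforce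
        show "disjoint_family_on (\<lambda>i. {max (l i) c<..<max (r i) c}) {..<N}"
          by (rule disjoint_family_on_bisimulation[OF dis]) auto
        have "(\<Sum>i<N. max (r i) c - max (l i) c) \<le> (\<Sum>i<N. r i - l i)" using lr by (intro sum_mono) (auto simp: max_def)
        then show "(\<Sum>i<N. max (r i) c - max (l i) c) < d2" using len by linarith
      qed
    next
      case False
      then have "(\<Sum>i<N. norm (x (max (r i) c) - x (max (l i) c))) = 0"
        using lr by (intro sum.neutral) (auto simp: max_def)
      then show ?thesis using \<open>e / 2 > 0\<close> by simp
    qed
    moreover have "(\<Sum>i<N. norm (x (r i) - x (l i))) \<le>
      (\<Sum>i<N. norm (x (min (r i) c) - x (min (l i) c)) + norm (x (max (r i) c) - x (max (l i) c)))"
    proof (rule sum_mono)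
      fix i assume "i \<in> {..<N}"
      then have "l i \<le> r i" using lr by auto
      then have "x (r i) - x (l i) = (x (min (r i) c) - x (min (l i) c)) + (x (max (r i) c) - x (max (l i) c))"
        by (auto simp: min_def max_def)
      then show "norm (x (r i) - x (l i)) \<le>
          norm (x (min (r i) c) - x (min (l i) c)) + norm (x (max (r i) c) - x (max (l i) c))"
        by (metis norm_triangle_ineq)
    qed
    ultimately show "(\<Sum>i<N. norm (x (r i) - x (l i))) < e" by (simp add: sum.distrib)
  qed
qed

lemma abs_continuous_on_mono_lipschitz_compose:
  fixes x :: "real \<Rightarrow> 'a::real_normed_vector" and \<theta> :: "real \<Rightarrow> real"
  assumes x: "abs_continuous_on {a..b} x" and mono: "mono \<theta>"
    and lip: "\<And>s t. s \<le> t \<Longrightarrow> \<theta> t - \<theta> s \<le> L * (t - s)"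
    and sub: "\<theta> c \<ge> a" "\<theta> d \<le> b"
  shows "abs_continuous_on {c..d} (\<lambda>t. x (\<theta> t))"
  unfolding abs_continuous_on_def
proof (intro allI impI)
  fix e :: real assume "e > 0"
  obtain \<delta> where \<delta>: "\<delta> > 0" "\<And>(N::nat) a' b'. (\<forall>i<N. a' i \<le> b' i \<and> {a' i..b' i} \<subseteq> {a..b}) \<Longrightarrow>
        disjoint_family_on (\<lambda>i. {a' i<..<b' i}) {..<N} \<Longrightarrow>
        (\<Sum>i<N. b' i - a' i) < \<delta> \<Longrightarrow> (\<Sum>i<N. norm (x (b' i) - x (a' i))) < e"
    by (rule abs_continuous_onE[OF x \<open>e > 0\<close>]) (rule that)
  \<comment> \<open>The maximum with 1 makes division by \<open>K\<close> safe, as the sign of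
    \<open>L\<close> is not prescribed.\<close>
  define K where "K = max L 1"
  have "K > 0" by (simp add: K_def)
  have lip': "\<theta> t - \<theta> s \<le> K * (t - s)" if "s \<le> t" for s t
    using lip[OF that] mult_right_mono[of L K "t - s"] that by (simp add: K_def)
  show "\<exists>\<delta>>0. \<forall>(N::nat) l r. (\<forall>i<N. l i \<le> r i \<and> {l i..r i} \<subseteq> {c..d}) \<longrightarrow>
        disjoint_family_on (\<lambda>i. {l i<..<r i}) {..<N} \<longrightarrow>
        (\<Sum>i<N. r i - l i) < \<delta> \<longrightarrow> (\<Sum>i<N. norm (x (\<theta> (r i)) - x (\<theta> (l i)))) < e"
  proof (intro exI conjI allI impI)
    show "\<delta> / K > 0" using \<delta> \<open>K > 0\<close> by simp
    fix N :: nat and l r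
    assume lr: "\<forall>i<N. l i \<le> r i \<and> {l i..r i} \<subseteq> {c..d}"
      and dis: "disjoint_family_on (\<lambda>i. {l i<..<r i}) {..<N}"
      and len: "(\<Sum>i<N. r i - l i) < \<delta> / K"
    show "(\<Sum>i<N. norm (x (\<theta> (r i)) - x (\<theta> (l i)))) < e"
    proof (rule \<delta>(2))
      show "\<forall>i<N. \<theta> (l i) \<le> \<theta> (r i) \<and> {\<theta> (l i)..\<theta> (r i)} \<subseteq> {a..b}"
      proof (intro allI impI)
        fix i assume "i < N"
        then have i: "l i \<le> r i" "c \<le> l i" "r i \<le> d" using lr by auto
        show "\<theta> (l i) \<le> \<theta> (r i) \<and> {\<theta> (l i)..\<theta> (r i)} \<subseteq> {a..b}"
          using monoD[OF mono i(1)] monoD[OF mono i(2)] monoD[OF mono i(3)] sub by auto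
      qed
      show "disjoint_family_on (\<lambda>i. {\<theta> (l i)<..<\<theta> (r i)}) {..<N}"
        unfolding disjoint_family_on_def
      proof (intro ballI impI)
        fix i j assume ij: "i \<in> {..<N}" "j \<in> {..<N}" "i \<noteq> j"
        then have e: "{l i<..<r i} \<inter> {l j<..<r j} = {}" using dis by (auto simp: disjoint_family_on_def)
        \<comment> \<open>Disjointness in terms of end points: this form, which includes empty
          intervals, is carried over by a map that is only known to be monotone.\<close>
        have "r i \<le> max (l i) (l j) \<or> r j \<le> max (l i) (l j)"
        proof (rule ccontr)
          assume "\<not> ?thesis"
          then have "max (l i) (l j) < min (r i) (r j)" by linarith
          then obtain m where "max (l i) (l j) < m" "m < min (r i) (r j)"
            using dense by blast
          then have "m \<in> {l i<..<r i} \<inter> {l j<..<r j}" by auto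
          then show False using e by blast
        qed
        then have "r i \<le> l i \<or> r j \<le> l j \<or> r i \<le> l j \<or> r j \<le> l i" by linarith
        then have "\<theta> (r i) \<le> \<theta> (l i) \<or> \<theta> (r j) \<le> \<theta> (l j) \<or> \<theta> (r i) \<le> \<theta> (l j) \<or> \<theta> (r j) \<le> \<theta> (l i)"
          using monoD[OF mono] by blast
        then show "{\<theta> (l i)<..<\<theta> (r i)} \<inter> {\<theta> (l j)<..<\<theta> (r j)} = {}" by auto
      qed
      have "(\<Sum>i<N. \<theta> (r i) - \<theta> (l i)) \<le> (\<Sum>i<N. K * (r i - l i))"
        using lr lip' by (intro sum_mono) auto
      also have "\<dots> < \<delta>" using len \<open>K > 0\<close> by (simp add: sum_distrib_left[symmetric] pos_less_divide_eq mult.commute)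
      finally show "(\<Sum>i<N. \<theta> (r i) - \<theta> (l i)) < \<delta>" .
    qed
  qed
qed

section \<open>Trajectory pieces and their reparametrization\<close>

text \<open>\<open>R\<close> bounds the overshoot and \<open>M\<close> the control, the latter being
  what keeps the clock bi-Lipschitz. All almost-everywhere conditions share one null set
  \<open>N\<close>; it may absorb the end points, so the two-sided derivative is no restriction
  there.\<close>

definition trajectory_piece ::
  "('a::euclidean_space) set \<Rightarrow> ('b::euclidean_space) set \<Rightarrow> (real \<Rightarrow> real) \<Rightarrow> ('a \<Rightarrow> 'b \<Rightarrow> 'a) \<Rightarrow>
   real \<Rightarrow> real \<Rightarrow> real \<Rightarrow> real \<Rightarrow> (real \<Rightarrow> 'a) \<Rightarrow> (real \<Rightarrow> 'b) \<Rightarrow> bool" where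
  "trajectory_piece C U \<sigma> g R M a b x u \<longleftrightarrow>
     a < b \<and> abs_continuous_on {a..b} x \<and> u \<in> borel_measurable (lebesgue_on {a..b}) \<and>
     (\<forall>t\<in>{a..b}. u t \<in> U \<and> x t \<notin> C \<and> infdist (x t) C \<le> R) \<and>
     (\<exists>N. negligible N \<and> (\<forall>t\<in>{a..b} - N. norm (u t) \<le> M \<and> norm (u t) \<le> \<sigma> (infdist (x t) C) \<and>
       (x has_vector_derivative g (x t) (u t)) (at t)))"

lemma borel_measurable_lebesgue_on_iff:
  fixes f :: "real \<Rightarrow> 'a::euclidean_space"
  assumes "S \<in> sets lebesgue"
  shows "f \<in> borel_measurable (lebesgue_on S) \<longleftrightarrow> (\<forall>A\<in>sets borel. f -` A \<inter> S \<in> sets lebesgue)"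
  using assms unfolding measurable_def by (auto simp: sets_restrict_space_iff)

lemma negligible_lipschitz_image:
  fixes F :: "real \<Rightarrow> real"
  assumes "negligible N" and "\<And>s t. \<bar>F t - F s\<bar> \<le> L * \<bar>t - s\<bar>"
  shows "negligible (F ` N)"
  using assms by (intro negligible_locally_Lipschitz_image) (auto intro!: exI[of _ UNIV] exI[of _ L])

text \<open>The new pair is \<open>x\<close> and \<open>u\<close> composed with the inverse of
  \<open>F\<close>, so all bounds on values carry over unchanged, and the chain rule contributes the
  factor 1 / q. The Lipschitz bound on \<open>F\<close> keeps images of exceptional sets null; the
  one on its inverse preserves absolute continuity.\<close>

lemma trajectory_piece_reparametrize:
  fixes x :: "real \<Rightarrow> 'a::euclidean_space" and u :: "real \<Rightarrow> 'b::euclidean_space"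
  assumes piece: "trajectory_piece C U \<sigma> f R M a b x u"
    and "0 < lo" and F: "\<And>s t. s \<le> t \<Longrightarrow> lo * (t - s) \<le> F t - F s \<and> F t - F s \<le> hi * (t - s)"
    and N0: "negligible N0"
    and deriv: "\<And>t. t \<in> {a..b} - N0 \<Longrightarrow> 0 < q t \<and> (F has_real_derivative q t) (at t) \<and>
                   g (x t) (u t) = f (x t) (u t) /\<^sub>R q t"
  obtains y v where "trajectory_piece C U \<sigma> g R M (F a) (F b) y v" "\<And>t. y (F t) = x t"
proof -
  have strict: "F s < F t" if "s < t" for s t
    using F[of s t] mult_pos_pos[OF \<open>0 < lo\<close>, of "t - s"] that by linarith
  then have sm: "strict_mono F" by (intro strict_monoI)
  then have inj: "inj F" by (rule strict_mono_imp_inj_on)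
  have lipF: "\<bar>F t - F s\<bar> \<le> hi * \<bar>t - s\<bar>" for s t
    using F[of s t] F[of t s] strict[of s t] strict[of t s] by (cases s t rule: linorder_cases) auto
  have Fcont: "continuous_on S F" for S
  proof (rule continuous_on_subset[OF _ subset_UNIV], rule lipschitz_on_continuous_on)
    show "(max hi 0)-lipschitz_on UNIV F"
    proof (rule lipschitz_onI)
      fix s t show "dist (F s) (F t) \<le> max hi 0 * dist s t"
        using lipF[of s t] mult_right_mono[of hi "max hi 0" "\<bar>t - s\<bar>"] by (simp add: dist_real_def abs_minus_commute)
    qed simp
  qed
  have surj: "\<exists>t. F t = s" for s
  proof -
    define r where "r = \<bar>s - F 0\<bar> / lo"
    have r: "lo * r = \<bar>s - F 0\<bar>" "r \<ge> 0" using \<open>0 < lo\<close> by (auto simp: r_def)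
    have "F (- r) \<le> s" "s \<le> F r" using F[of "-r" 0] F[of 0 r] r by auto
    then show ?thesis using IVT'[of F "- r" s r] Fcont r by auto
  qed
  define \<theta> where "\<theta> = inv F"
  have \<theta>F[simp]: "\<theta> (F t) = t" for t using inj by (simp add: \<theta>_def)
  have F\<theta>[simp]: "F (\<theta> s) = s" for s using surj by (metis \<theta>F)
  have mono\<theta>: "mono \<theta>"
    by (rule monoI) (metis F\<theta> sm strict_mono_less_eq)
  have lip\<theta>: "\<theta> t - \<theta> s \<le> (1 / lo) * (t - s)" if "s \<le> t" for s t
    using F[OF monoD[OF mono\<theta> that]] \<open>0 < lo\<close> by (simp add: field_simps)
  have \<theta>cont: "isCont \<theta> s" for s
  proof -
    have "isCont \<theta> (F (\<theta> s))"
      by (rule isCont_inverse_function[of 1]) (use Fcont[of UNIV] in \<open>auto simp: continuous_on_eq_continuous_at\<close>)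
    then show ?thesis by simp
  qed
  have img: "{F a..F b} = F ` {a..b}"
  proof
    show "F ` {a..b} \<subseteq> {F a..F b}" using sm by (auto simp: strict_mono_less_eq)
    show "{F a..F b} \<subseteq> F ` {a..b}"
    proof
      fix s assume "s \<in> {F a..F b}"
      then have "\<theta> s \<in> {a..b}" using monoD[OF mono\<theta>, of "F a" s] monoD[OF mono\<theta>, of s "F b"] by auto
      then show "s \<in> F ` {a..b}" by (metis F\<theta> imageI)
    qed
  qed
  obtain N where ab: "a < b" and ac: "abs_continuous_on {a..b} x" and meas: "u \<in> borel_measurable (lebesgue_on {a..b})"
    and vals: "\<And>t. t \<in> {a..b} \<Longrightarrow> u t \<in> U \<and> x t \<notin> C \<and> infdist (x t) C \<le> R"
    and N: "negligible N" "\<And>t. t \<in> {a..b} - N \<Longrightarrow> norm (u t) \<le> M \<and> norm (u t) \<le> \<sigma> (infdist (x t) C) \<and>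
       (x has_vector_derivative f (x t) (u t)) (at t)"
    using piece unfolding trajectory_piece_def by blast
  have "trajectory_piece C U \<sigma> g R M (F a) (F b) (\<lambda>s. x (\<theta> s)) (\<lambda>s. u (\<theta> s))"
    unfolding trajectory_piece_def
  proof (intro conjI)
    show "F a < F b" using ab by (rule strict)
    show "abs_continuous_on {F a..F b} (\<lambda>s. x (\<theta> s))"
      by (rule abs_continuous_on_mono_lipschitz_compose[OF ac mono\<theta> lip\<theta>]) auto
    show "(\<lambda>s. u (\<theta> s)) \<in> borel_measurable (lebesgue_on {F a..F b})"
    proof (subst borel_measurable_lebesgue_on_iff, simp, intro ballI)
      fix A :: "'b set" assume "A \<in> sets borel"
      then have "u -` A \<inter> {a..b} \<in> sets lebesgue"
        using meas by (subst (asm) borel_measurable_lebesgue_on_iff) auto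
      \<comment> \<open>The preimage under the inverse of \<open>F\<close> is an image under
        \<open>F\<close>. Continuity alone would not keep Lebesgue sets measurable; null sets must
        also go to null sets.\<close>
      then have "F ` (u -` A \<inter> {a..b}) \<in> sets lebesgue"
        by (rule sets_lebesgue_continuous_image[OF _ Fcont, of _ UNIV])
           (auto intro: negligible_lipschitz_image[OF _ lipF])
      moreover have "(\<lambda>s. u (\<theta> s)) -` A \<inter> {F a..F b} = F ` (u -` A \<inter> {a..b})"
        unfolding img by auto
      ultimately show "(\<lambda>s. u (\<theta> s)) -` A \<inter> {F a..F b} \<in> sets lebesgue" by simp
    qed
    show "\<forall>t\<in>{F a..F b}. u (\<theta> t) \<in> U \<and> x (\<theta> t) \<notin> C \<and> infdist (x (\<theta> t)) C \<le> R"
      unfolding img using vals by auto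
    show "\<exists>N. negligible N \<and> (\<forall>t\<in>{F a..F b} - N. norm (u (\<theta> t)) \<le> M \<and>
        norm (u (\<theta> t)) \<le> \<sigma> (infdist (x (\<theta> t)) C) \<and>
        ((\<lambda>s. x (\<theta> s)) has_vector_derivative g (x (\<theta> t)) (u (\<theta> t))) (at t))"
    proof (intro exI conjI ballI)
      show "negligible (F ` (N \<union> N0))"
        by (rule negligible_lipschitz_image[OF _ lipF]) (use N N0 in auto)
      fix s assume "s \<in> {F a..F b} - F ` (N \<union> N0)"
      then have "s \<in> F ` {a..b}" and s: "s \<notin> F ` (N \<union> N0)" unfolding img by auto
      then obtain t where "s = F t" "t \<in> {a..b}" by auto
      then have t: "s = F t" "t \<in> {a..b}" "t \<notin> N" "t \<notin> N0" using s by auto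
      show "norm (u (\<theta> s)) \<le> M" "norm (u (\<theta> s)) \<le> \<sigma> (infdist (x (\<theta> s)) C)" using N(2)[of t] t by auto
      have "(\<theta> has_real_derivative inverse (q t)) (at (F t))"
      proof (rule DERIV_inverse_function[of F _ _ _ "F t - 1" "F t + 1"])
        show "(F has_real_derivative q t) (at (\<theta> (F t)))" using deriv t by auto
        show "q t \<noteq> 0" using deriv t by force
      qed (use \<theta>cont in auto)
      then have "(\<theta> has_vector_derivative inverse (q t)) (at s)"
        using t by (simp add: has_real_derivative_iff_has_vector_derivative)
      moreover have "(x has_vector_derivative f (x t) (u t)) (at (\<theta> s))" using N(2)[of t] t by auto
      ultimately have "((x \<circ> \<theta>) has_vector_derivative inverse (q t) *\<^sub>R f (x t) (u t)) (at s)"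
        by (rule vector_diff_chain_at)
      then show "((\<lambda>s. x (\<theta> s)) has_vector_derivative g (x (\<theta> s)) (u (\<theta> s))) (at s)"
        using deriv[of t] t by (simp add: o_def)
    qed
  qed
  then show thesis by (rule that) simp
qed

lemma trajectory_piece_shift:
  assumes "trajectory_piece C U \<sigma> g R M 0 \<tau> x u"
  obtains y v where "trajectory_piece C U \<sigma> g R M s (s + \<tau>) y v" "\<And>t. y (s + t) = x t"
proof -
  have deriv: "0 < (1::real) \<and> ((+) s has_real_derivative 1) (at t) \<and> g (x t) (u t) = g (x t) (u t) /\<^sub>R 1" for t
    by (auto intro!: derivative_eq_intros)
  show thesis
    by (rule trajectory_piece_reparametrize[OF assms, of 1 "(+) s" 1 "{}" "\<lambda>_. 1" g])
       (use deriv that in auto)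
qed

text \<open>On the clock with rate h (norm u) the velocity becomes f / h = g. The control bound
  \<open>M\<close> keeps this rate between \<open>lo\<close> and \<open>hi\<close>, whence the
  estimate of the new duration.\<close>

lemma trajectory_piece_time_change:
  fixes f g :: "'a::euclidean_space \<Rightarrow> 'b::euclidean_space \<Rightarrow> 'a"
  assumes piece: "trajectory_piece C U \<sigma> f R M 0 \<tau> x u"
    and h: "h \<in> borel_measurable borel" and "0 < lo" and bd: "\<And>r. 0 \<le> r \<Longrightarrow> r \<le> M \<Longrightarrow> lo \<le> h r \<and> h r \<le> hi"
    and "lo \<le> hi"
    and g: "\<And>x u. g x u = f x u /\<^sub>R h (norm u)"
  obtains \<tau>' y v where "trajectory_piece C U \<sigma> g R M 0 \<tau>' y v" "y 0 = x 0" "y \<tau>' = x \<tau>" "\<tau>' \<le> hi * \<tau>"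
proof -
  obtain N where \<tau>: "0 < \<tau>" and meas: "u \<in> borel_measurable (lebesgue_on {0..\<tau>})"
    and N: "negligible N" "\<And>t. t \<in> {0..\<tau>} - N \<Longrightarrow> norm (u t) \<le> M"
    using piece unfolding trajectory_piece_def by blast
  define w where "w t = (if t \<in> {0..\<tau>} then u t else 0)" for t
  have "w \<in> borel_measurable lebesgue" unfolding w_def
    by (rule borel_measurable_if_I[OF meas]) simp
  \<comment> \<open>Clamping makes both bounds hold everywhere, including the null set where norm u
    may exceed \<open>M\<close>; off that set it is inactive inside the piece.\<close>
  define q where "q t = max lo (min hi (h (norm (w t))))" for t
  have q: "q \<in> borel_measurable lebesgue" unfolding q_def
    using \<open>w \<in> borel_measurable lebesgue\<close> h by measurable
  have q_bd: "lo \<le> q t \<and> q t \<le> hi" for t using \<open>lo \<le> hi\<close> by (auto simp: q_def)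
  have q_eq: "q t = h (norm (u t))" if "t \<in> {0..\<tau>} - N" for t
    using that bd[of "norm (u t)"] N(2)[OF that] by (auto simp: q_def w_def)
  obtain F where F: "F 0 = 0" "\<And>a b. a \<le> b \<Longrightarrow> lo * (b - a) \<le> F b - F a \<and> F b - F a \<le> hi * (b - a)"
    "negligible {t. \<not> (F has_real_derivative q t) (at t)}"
    by (rule ex_bilipschitz_primitive[OF q \<open>0 < lo\<close> q_bd]) (rule that)
  obtain y v where y: "trajectory_piece C U \<sigma> g R M (F 0) (F \<tau>) y v" "\<And>t. y (F t) = x t"
  proof (rule trajectory_piece_reparametrize[OF piece \<open>0 < lo\<close> F(2)])
    show "negligible (N \<union> {t. \<not> (F has_real_derivative q t) (at t)})" using N F(3) by simp
    show "0 < q t \<and> (F has_real_derivative q t) (at t) \<and> g (x t) (u t) = f (x t) (u t) /\<^sub>R q t"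
      if "t \<in> {0..\<tau>} - (N \<union> {t. \<not> (F has_real_derivative q t) (at t)})" for t
      using that q_bd[of t] \<open>0 < lo\<close> q_eq[of t] g by auto
  qed (assumption | rule that)+
  show thesis
  proof
    show "trajectory_piece C U \<sigma> g R M 0 (F \<tau>) y v" using y F by simp
    show "y 0 = x 0" using y(2)[of 0] F by simp
    show "y (F \<tau>) = x \<tau>" by (rule y(2))
    show "F \<tau> \<le> hi * \<tau>" using F(2)[of 0 \<tau>] F(1) \<tau> by simp
  qed
qed

section \<open>Descending pieces and their concatenation\<close>

lemma AE_lebesgue_on_iff_negligible:
  assumes "S \<in> sets lebesgue"
  shows "(AE t in lebesgue_on S. P t) \<longleftrightarrow> negligible {t \<in> S. \<not> P t}"
proof
  assume "AE t in lebesgue_on S. P t"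
  then have "AE t in lebesgue. t \<in> S \<longrightarrow> P t" using assms by (simp add: AE_restrict_space_iff)
  then obtain N where "N \<in> null_sets lebesgue" "{t \<in> space lebesgue. \<not> (t \<in> S \<longrightarrow> P t)} \<subseteq> N"
    unfolding eventually_ae_filter by (elim bexE) (rule that)
  then show "negligible {t \<in> S. \<not> P t}"
    using negligible_subset[of N "{t \<in> S. \<not> P t}"] by (auto simp: negligible_iff_null_sets)
next
  assume "negligible {t \<in> S. \<not> P t}"
  then have "AE t in lebesgue. t \<in> S \<longrightarrow> P t"
    by (intro AE_I'[of "{t \<in> S. \<not> P t}"]) (auto simp: negligible_iff_null_sets)
  then show "AE t in lebesgue_on S. P t" using assms by (simp add: AE_restrict_space_iff)
qed

lemma time_dom_sets_lebesgue: "time_dom T \<in> sets lebesgue"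
proof -
  have "time_dom T = (case T of ereal r \<Rightarrow> {0..<r} | PInfty \<Rightarrow> {0..} | MInfty \<Rightarrow> {})"
    by (cases T) (auto simp: time_dom_def)
  then show ?thesis by (cases T) auto
qed

lemma class_KL_mono:
  assumes "class_KL \<beta>" "0 \<le> r" "r \<le> r'" "0 \<le> t" "t \<le> t'"
  shows "\<beta> r t' \<le> \<beta> r' t"
proof -
  have "\<beta> r t' \<le> \<beta> r t"
  proof (cases "r = 0 \<or> t = t'")
    case False
    then have "strict_antimono_on {0..} (\<beta> r)" using assms unfolding class_KL_def by auto
    then have "\<beta> r t' < \<beta> r t" by (rule monotone_onD) (use assms False in auto)
    then show ?thesis by simp
  next
    case True
    then show ?thesis using assms unfolding class_KL_def by auto
  qed
  also have "\<beta> r t \<le> \<beta> r' t"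
  proof (cases "r = r'")
    case False
    have "strict_mono_on {0..} (\<lambda>r. \<beta> r t)" using assms unfolding class_KL_def by auto
    then have "\<beta> r t < \<beta> r' t" by (rule monotone_onD) (use assms False in auto)
    then show ?thesis by simp
  qed simp
  finally show ?thesis .
qed

text \<open>The cut is at the first time the distance equals \<rho>. Up to then the distance lies
  between \<rho> and \<beta> D 0, where \<open>M\<close> dominates \<sigma>; the decay of \<beta>
  forces that time to be at most \<open>S\<close>.\<close>

lemma ex_descending_piece:
  assumes KL: "class_KL \<beta>"
    and adm: "admissible_pair C U f T x u"
    and decay: "\<And>t. 0 \<le> t \<Longrightarrow> infdist (x t) C \<le> \<beta> (infdist (x 0) C) t"
    and ctrl: "AE t in lebesgue_on (time_dom T). norm (u t) \<le> \<sigma> (infdist (x t) C)"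
    and \<rho>: "0 < \<rho>" "\<rho> < infdist (x 0) C" "infdist (x 0) C \<le> D"
    and S: "0 \<le> S" "\<beta> D S \<le> \<rho>"
    and M: "\<And>r. \<rho> \<le> r \<Longrightarrow> r \<le> \<beta> D 0 \<Longrightarrow> \<sigma> r \<le> M"
  obtains \<tau> where "trajectory_piece C U \<sigma> f (\<beta> D 0) M 0 \<tau> x u" "infdist (x \<tau>) C = \<rho>" "\<tau> \<le> S"
proof -
  let ?d = "\<lambda>t. infdist (x t) C"
  have "0 < T" and Linf: "Linf_loc (time_dom T) U u" and out: "\<And>t. t \<in> time_dom T \<Longrightarrow> x t \<notin> C"
    and lac: "locally_abs_continuous_on (time_dom T) x"
    and der: "AE t in lebesgue_on (time_dom T). (x has_vector_derivative f (x t) (u t)) (at t)"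
    and lim: "T < \<infinity> \<Longrightarrow> (?d \<longlongrightarrow> 0) (at_left (real_of_ereal T))"
    using adm unfolding admissible_pair_def by auto
  have le_D: "?d t \<le> \<beta> D t" if "0 \<le> t" for t
    using decay[OF that] class_KL_mono[OF KL infdist_nonneg \<rho>(3) that order_refl] by linarith
  have le_D0: "?d t \<le> \<beta> D 0" if "0 \<le> t" for t
    using decay[OF that] class_KL_mono[OF KL infdist_nonneg \<rho>(3) order_refl that] by linarith
  obtain t1 where t1: "t1 \<in> time_dom T" "t1 \<le> S" "?d t1 \<le> \<rho>"
  proof (cases "ereal S < T")
    case True
    then show ?thesis using that[of S] le_D[OF S(1)] S by (auto simp: time_dom_def)
  next
    \<comment> \<open>The trajectory ends at some T' \<le> S; its distance tends to 0 there, so it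
      falls below \<rho> even earlier.\<close>
    case False
    then obtain T' where T': "T = ereal T'" "T' \<le> S" "0 < T'" using \<open>0 < T\<close> by (cases T) auto
    have "\<forall>\<^sub>F t in at_left T'. ?d t < \<rho>" using lim \<rho>(1) order_tendstoD(2) T' by fastforce
    moreover have "\<forall>\<^sub>F t in at_left T'. t < T'" "\<forall>\<^sub>F t in at_left T'. 0 < t"
      using T'(3) by (auto simp: eventually_at_left_field)
    ultimately have "\<forall>\<^sub>F t in at_left T'. ?d t < \<rho> \<and> t < T' \<and> 0 < t" by eventually_elim auto
    then obtain t where "?d t < \<rho>" "t < T'" "0 < t"
      using eventually_happens'[OF trivial_limit_at_left_real] by blast
    then show ?thesis using that[of t] T' by (auto simp: time_dom_def)
  qed
  have "0 \<le> t1" using t1 by (simp add: time_dom_def)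
  have sub: "{0..t} \<subseteq> time_dom T" if "t \<le> t1" for t
    using t1(1) that le_less_trans[of "ereal _" "ereal t1" T] by (auto simp: time_dom_def)
  have ac: "abs_continuous_on {0..t} x" if "t \<le> t1" for t
    using lac sub[OF that] by (simp add: locally_abs_continuous_on_def)
  have cont: "continuous_on {0..t} ?d" if "t \<le> t1" for t
    using abs_continuous_on_imp_continuous_on[OF ac[OF that]] by (rule continuous_on_infdist)
  let ?S = "{t \<in> {0..t1}. ?d t \<le> \<rho>}"
  have "compact ?S"
  proof -
    have "closed ?S"
      using continuous_closed_preimage[OF cont[OF order_refl] closed_atLeastAtMost closed_atMost[of \<rho>]]
      by (simp add: vimage_def Int_def)
    moreover have "bounded ?S" by (rule bounded_subset[OF bounded_closed_interval[of 0 t1]]) auto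
    ultimately show ?thesis by (simp add: compact_eq_bounded_closed)
  qed
  moreover have "?S \<noteq> {}" using t1 \<open>0 \<le> t1\<close> by auto
  ultimately obtain \<tau> where \<tau>: "\<tau> \<in> ?S" "\<And>t. t \<in> ?S \<Longrightarrow> \<tau> \<le> t"
    using compact_attains_inf[of ?S] by blast
  have \<tau>1: "0 \<le> \<tau>" "\<tau> \<le> t1" "?d \<tau> \<le> \<rho>" using \<tau>(1) by auto
  \<comment> \<open>The intermediate value theorem gives a time up to \<tau> with distance exactly
    \<rho>; minimality identifies it with \<tau>.\<close>
  have "\<exists>t\<ge>0. t \<le> \<tau> \<and> ?d t = \<rho>"
    using IVT2'[of ?d \<tau> \<rho> 0] \<tau>1 \<rho> cont by auto
  then have d\<tau>: "?d \<tau> = \<rho>" using \<tau>(2) \<tau>1 by force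
  have ge: "\<rho> \<le> ?d t" if "t \<in> {0..\<tau>}" for t
  proof (rule ccontr)
    assume "\<not> \<rho> \<le> ?d t"
    then have "t \<in> ?S" using that \<tau>1 by auto
    then have "t = \<tau>" using \<tau>(2) that by force
    then show False using d\<tau> \<open>\<not> \<rho> \<le> ?d t\<close> by simp
  qed
  have "\<tau> \<noteq> 0" using d\<tau> \<rho> by auto
  note sub\<tau> = sub[OF \<tau>1(2)]
  have vals: "u t \<in> U \<and> x t \<notin> C \<and> ?d t \<le> \<beta> D 0" if "t \<in> {0..\<tau>}" for t
    using that sub\<tau> out Linf le_D0 by (auto simp: Linf_loc_def)
  have "trajectory_piece C U \<sigma> f (\<beta> D 0) M 0 \<tau> x u"
    unfolding trajectory_piece_def
  proof (intro conjI ballI)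
    show "0 < \<tau>" using \<open>\<tau> \<noteq> 0\<close> \<tau>1 by simp
    show "abs_continuous_on {0..\<tau>} x" by (rule ac[OF \<tau>1(2)])
    have "u \<in> borel_measurable (lebesgue_on (time_dom T))" using Linf by (simp add: Linf_loc_def)
    then show "u \<in> borel_measurable (lebesgue_on {0..\<tau>})"
      using sub\<tau> measurable_restrict_mono by blast
    let ?N1 = "{t \<in> time_dom T. \<not> (x has_vector_derivative f (x t) (u t)) (at t)}"
    let ?N2 = "{t \<in> time_dom T. \<not> norm (u t) \<le> \<sigma> (?d t)}"
    have "negligible (?N1 \<union> ?N2)"
      using der ctrl by (simp add: AE_lebesgue_on_iff_negligible time_dom_sets_lebesgue)
    moreover have "norm (u t) \<le> M \<and> norm (u t) \<le> \<sigma> (?d t) \<and> (x has_vector_derivative f (x t) (u t)) (at t)"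
      if t: "t \<in> {0..\<tau>} - (?N1 \<union> ?N2)" for t
    proof -
      have "t \<in> {0..\<tau>}" "t \<in> time_dom T" using t sub\<tau> by auto
      then have "norm (u t) \<le> \<sigma> (?d t)" "(x has_vector_derivative f (x t) (u t)) (at t)" using t by auto
      moreover have "\<sigma> (?d t) \<le> M" using M ge vals \<open>t \<in> {0..\<tau>}\<close> by auto
      ultimately show ?thesis by auto
    qed
    ultimately show "\<exists>N. negligible N \<and> (\<forall>t\<in>{0..\<tau>} - N. norm (u t) \<le> M \<and> norm (u t) \<le> \<sigma> (?d t) \<and>
       (x has_vector_derivative f (x t) (u t)) (at t))" by blast
  qed (use vals in auto)
  then show thesis using d\<tau> t1 \<tau>1 by (intro that[of \<tau>]) auto
qed

text \<open>The segment from \<open>x\<close> to a nearest point of \<open>C\<close> must cross the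
  frontier. \<open>C\<close> itself may be unbounded, but its frontier is compact in the
  application, so frontier points close to a trajectory have a limit point.\<close>

lemma ex_frontier_point_within_infdist:
  fixes C :: "'a::euclidean_space set"
  assumes "closed C" "C \<noteq> {}" "x \<notin> C"
  obtains q where "q \<in> frontier C" "dist x q \<le> infdist x C"
proof -
  obtain p where p: "p \<in> C" "infdist x C = dist x p" using infdist_attains_inf[OF assms(1,2)] by blast
  have "closed_segment x p \<inter> frontier C \<noteq> {}"
    by (rule connected_Int_frontier) (use p assms in auto)
  then obtain q where "q \<in> closed_segment x p" "q \<in> frontier C" by blast
  then show thesis using that[of q] p dist_in_closed_segment[of q x p] by (simp add: dist_commute)
qed

text \<open>Because \<open>R\<close> tends to 0, a finite supremum of the joining times means
  arrival at \<open>C\<close>. The last conclusion has the form needed for a descent estimate: a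
  distance as large as \<open>R j\<close> can occur only before \<open>s (Suc j)\<close>.\<close>

lemma concatenate_trajectory_pieces:
  fixes C :: "'a::euclidean_space set" and U :: "'b::euclidean_space set"
  assumes C: "closed C" "C \<noteq> {}" "compact (frontier C)"
    and s0: "s 0 = 0" and R: "R \<longlonglongrightarrow> 0"
    and piece: "\<And>j. trajectory_piece C U \<sigma> g (R j) (M j) (s j) (s (Suc j)) (y j) (v j)"
    and join: "\<And>j. y j (s (Suc j)) = y (Suc j) (s (Suc j))"
  obtains T x u where "admissible_pair C U g T x u" "extended_past C T x" "x 0 = y 0 0"
    "AE t in lebesgue_on (time_dom T). norm (u t) \<le> \<sigma> (infdist (x t) C)"
    "\<And>t. 0 \<le> t \<Longrightarrow> x t \<in> C \<or> (\<exists>j. t < s (Suc j) \<and> infdist (x t) C \<le> R j)"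
proof -
  have s_less: "s j < s (Suc j)" and acy: "abs_continuous_on {s j..s (Suc j)} (y j)"
    and meas: "v j \<in> borel_measurable (lebesgue_on {s j..s (Suc j)})"
    and vals: "\<And>t. t \<in> {s j..s (Suc j)} \<Longrightarrow> v j t \<in> U \<and> y j t \<notin> C \<and> infdist (y j t) C \<le> R j" for j
    using piece[of j] unfolding trajectory_piece_def by auto
  have "\<forall>j. \<exists>N. negligible N \<and> (\<forall>t\<in>{s j..s (Suc j)} - N. norm (v j t) \<le> M j \<and> norm (v j t) \<le> \<sigma> (infdist (y j t) C) \<and>
       (y j has_vector_derivative g (y j t) (v j t)) (at t))"
    using piece unfolding trajectory_piece_def by blast
  then obtain N where N: "\<And>j. negligible (N j)"
    "\<And>j t. t \<in> {s j..s (Suc j)} - N j \<Longrightarrow> norm (v j t) \<le> M j \<and> norm (v j t) \<le> \<sigma> (infdist (y j t) C) \<and>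
       (y j has_vector_derivative g (y j t) (v j t)) (at t)"
    by metis
  have sm: "strict_mono s" using s_less by (simp add: strict_mono_Suc_iff)
  define T where "T = (SUP j. ereal (s j))"
  define idx where "idx t = (LEAST j. t < s (Suc j))" for t
  have idx: "s (idx t) \<le> t \<and> t < s (Suc (idx t))" if "0 \<le> t" "t < s j" for t j
  proof -
    have "t < s (Suc j)" using that s_less[of j] by simp
    then have 1: "t < s (Suc (idx t))" unfolding idx_def by (rule LeastI)
    have "s (idx t) \<le> t"
    proof (cases "idx t")
      case 0
      then show ?thesis using s0 that by simp
    next
      case (Suc i)
      then have "\<not> t < s (Suc i)" using not_less_Least[of i "\<lambda>j. t < s (Suc j)"] by (simp add: idx_def)
      then show ?thesis using Suc by simp
    qed
    then show ?thesis using 1 by simp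
  qed
  have idx_eq: "idx t = j" if "s j \<le> t" "t < s (Suc j)" for t j
    unfolding idx_def
  proof (rule Least_equality)
    show "j \<le> i" if "t < s (Suc i)" for i
      using \<open>s j \<le> t\<close> that strict_mono_less[OF sm, of j "Suc i"] by linarith
  qed fact
  have td: "t \<in> time_dom T \<longleftrightarrow> 0 \<le> t \<and> (\<exists>j. t < s j)" for t
    by (auto simp: time_dom_def T_def less_SUP_iff)
  have s_nn: "0 \<le> s j" for j using strict_mono_less_eq[OF sm, of 0 j] s0 by simp
  have td_cases: "\<exists>j. idx t = j \<and> s j \<le> t \<and> t < s (Suc j)" if "t \<in> time_dom T" for t
    using that idx unfolding td by blast
  have s_td: "s j \<in> time_dom T" for j using s_nn s_less[of j] td by blast
  have "0 < T" using s_td[of 0] s0 by (simp add: time_dom_def zero_ereal_def)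
  \<comment> \<open>The end value \<open>z\<close> is needed before \<open>x\<close> can be defined.
    The joining points come within \<open>R j\<close> of frontier points, these have a convergent
    subsequence, and along it the joining points share the limit.\<close>
  have "\<exists>z. T < \<infinity> \<longrightarrow> z \<in> frontier C \<and> (\<exists>r. strict_mono r \<and> (\<lambda>i. y (r i) (s (r i))) \<longlonglongrightarrow> z)"
  proof -
    have "\<forall>j. \<exists>q. q \<in> frontier C \<and> dist (y j (s j)) q \<le> R j"
    proof
      fix j
      have "y j (s j) \<notin> C" "infdist (y j (s j)) C \<le> R j" using vals[of "s j" j] s_less[of j] by auto
      then show "\<exists>q. q \<in> frontier C \<and> dist (y j (s j)) q \<le> R j"
        using ex_frontier_point_within_infdist[OF C(1,2)] by (metis order_trans)
    qed
    then obtain q where q: "\<And>j. q j \<in> frontier C" "\<And>j. dist (y j (s j)) (q j) \<le> R j" by metis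
    obtain z r where zr: "z \<in> frontier C" "strict_mono (r :: nat \<Rightarrow> nat)" "(q \<circ> r) \<longlonglongrightarrow> z"
      using C(3) q(1) unfolding compact_def by metis
    have "(\<lambda>j. dist (y j (s j)) (q j)) \<longlonglongrightarrow> 0"
      by (rule tendsto_sandwich[OF _ _ tendsto_const R]) (use q in auto)
    then have "(\<lambda>j. y j (s j) - q j) \<longlonglongrightarrow> 0" by (simp add: dist_norm tendsto_norm_zero_iff)
    then have "(\<lambda>i. y (r i) (s (r i)) - q (r i)) \<longlonglongrightarrow> 0" using LIMSEQ_subseq_LIMSEQ[OF _ zr(2)] by (fastforce simp: o_def)
    then have "(\<lambda>i. y (r i) (s (r i))) \<longlonglongrightarrow> z" using tendsto_add[OF _ zr(3)] by (fastforce simp: o_def)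
    then show ?thesis using zr by blast
  qed
  then obtain z where z: "T < \<infinity> \<Longrightarrow> z \<in> frontier C \<and> (\<exists>r. strict_mono r \<and> (\<lambda>i. y (r i) (s (r i))) \<longlonglongrightarrow> z)"
    by blast
  define x where "x t = (if t \<in> time_dom T then y (idx t) t else z)" for t
  define u where "u t = v (idx t) t" for t
  have xj: "x t = y j t" and uj: "u t = v j t" if "s j \<le> t" "t < s (Suc j)" for t j
    using idx_eq[OF that] that order_trans[OF s_nn that(1)] by (auto simp: x_def u_def td)
  \<comment> \<open>By \<open>join\<close> the agreement extends to the right end point, so absolute
    continuity can be taken over on closed intervals.\<close>
  have xj': "x t = y j t" if "t \<in> {s j..s (Suc j)}" for t j
  proof (cases "t = s (Suc j)")
    case True
    then show ?thesis using xj[of "Suc j" t] s_less[of "Suc j"] join by simp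
  next
    case False
    then show ?thesis using xj[of j t] that by simp
  qed
  have vals': "u t \<in> U \<and> x t \<notin> C" if "t \<in> time_dom T" for t
    using td_cases[OF that] xj uj vals by (metis atLeastAtMost_iff less_imp_le)
  \<comment> \<open>The joining times are included because the two-sided derivative may fail
    there.\<close>
  let ?N = "\<Union>j. insert (s j) (N j)"
  have negN: "negligible ?N"
    using N(1) by (intro negligible_Union_nat) simp
  have good: "\<exists>j. s j \<le> t \<and> t < s (Suc j) \<and> norm (u t) \<le> M j \<and> norm (u t) \<le> \<sigma> (infdist (x t) C) \<and>
       (x has_vector_derivative g (x t) (u t)) (at t)" if t: "t \<in> time_dom T" "t \<notin> ?N" for t
  proof -
    obtain j where j: "s j \<le> t" "t < s (Suc j)" using td_cases[OF t(1)] by blast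
    then have "s j < t" using t(2) by (metis UN_I UNIV_I insertI1 order_le_less)
    have *: "norm (v j t) \<le> M j \<and> norm (v j t) \<le> \<sigma> (infdist (y j t) C) \<and>
       (y j has_vector_derivative g (y j t) (v j t)) (at t)"
      using N(2)[of t j] t(2) j by auto
    have "(x has_vector_derivative g (y j t) (v j t)) (at t)"
      by (rule has_vector_derivative_transform_within_open[of "y j" _ _ "{s j<..<s (Suc j)}"])
         (use * \<open>s j < t\<close> j xj[symmetric] in auto)
    then show ?thesis using * j by (auto simp: xj uj intro!: exI[of _ j])
  qed
  have tdm: "time_dom T \<in> sets lebesgue" by (rule time_dom_sets_lebesgue)
  have limT: "s \<longlonglongrightarrow> real_of_ereal T" if "T < \<infinity>"
  proof -
    have "(\<lambda>j. ereal (s j)) \<longlonglongrightarrow> T" unfolding T_def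
      by (rule LIMSEQ_SUP) (use sm in \<open>auto simp: incseq_def strict_mono_less_eq\<close>)
    then show ?thesis using that \<open>0 < T\<close> by (cases T) auto
  qed
  show thesis
  proof
    show "x 0 = y 0 0" using xj[of 0 0] s0 s_less[of 0] by simp
    show "AE t in lebesgue_on (time_dom T). norm (u t) \<le> \<sigma> (infdist (x t) C)"
      unfolding AE_lebesgue_on_iff_negligible[OF tdm]
      by (rule negligible_subset[OF negN]) (use good in blast)
    show "x t \<in> C \<or> (\<exists>j. t < s (Suc j) \<and> infdist (x t) C \<le> R j)" if "0 \<le> t" for t
    proof (cases "t \<in> time_dom T")
      case True
      then obtain j where "s j \<le> t" "t < s (Suc j)" using td_cases by blast
      then show ?thesis using xj vals[of t j] by auto
    next
      case False
      then have "T < \<infinity>" using that by (auto simp: time_dom_def)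
      then show ?thesis using z False C(1) frontier_subset_closed by (auto simp: x_def)
    qed
    show "extended_past C T x"
      unfolding extended_past_def
    proof (intro impI)
      assume "T < \<infinity>"
      then obtain r where r: "z \<in> frontier C" "strict_mono r" "(\<lambda>i. y (r i) (s (r i))) \<longlonglongrightarrow> z"
        using z by blast
      have "x (s (r i)) = y (r i) (s (r i))" for i using s_less by (simp add: xj)
      then have "(\<lambda>i. x (s (r i))) \<longlonglongrightarrow> z" using r(3) by simp
      moreover have "range (\<lambda>i. s (r i)) \<subseteq> time_dom T" using s_td by auto
      moreover have "incseq (\<lambda>i. s (r i))" using sm r(2) by (auto simp: incseq_def strict_mono_less_eq)
      moreover have "(\<lambda>i. s (r i)) \<longlonglongrightarrow> real_of_ereal T"
        using LIMSEQ_subseq_LIMSEQ[OF limT[OF \<open>T < \<infinity>\<close>] r(2)] by (simp add: o_def)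
      moreover have "x t = z" if "real_of_ereal T \<le> t" for t
        using that \<open>T < \<infinity>\<close> \<open>0 < T\<close> by (cases T) (auto simp: x_def time_dom_def)
      ultimately show "\<exists>z\<in>frontier C. \<exists>\<tau>::nat \<Rightarrow> real.
          range \<tau> \<subseteq> time_dom T \<and> incseq \<tau> \<and> \<tau> \<longlonglongrightarrow> real_of_ereal T \<and>
          (\<lambda>i. x (\<tau> i)) \<longlonglongrightarrow> z \<and> (\<forall>t\<ge>real_of_ereal T. x t = z)"
        using r(1) by blast
    qed
    show "admissible_pair C U g T x u"
      unfolding admissible_pair_def
    proof (intro conjI impI ballI)
      show "0 < T" by fact
      show "x t \<notin> C" if "t \<in> time_dom T" for t using vals'[OF that] by simp
      show "AE t in lebesgue_on (time_dom T). (x has_vector_derivative g (x t) (u t)) (at t)"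
        unfolding AE_lebesgue_on_iff_negligible[OF tdm]
        by (rule negligible_subset[OF negN]) (use good in blast)
      have ac: "abs_continuous_on {0..s n} x" for n
      proof (induction n)
        case 0
        have "abs_continuous_on {s 0..s (Suc 0)} x"
          using acy[of 0] by (subst abs_continuous_on_cong[OF xj']) auto
        then show ?case by (rule abs_continuous_on_subset) (use s0 s_less[of 0] in auto)
      next
        case (Suc n)
        have "abs_continuous_on {s n..s (Suc n)} x"
          using acy[of n] by (subst abs_continuous_on_cong[OF xj']) auto
        then show ?case by (rule abs_continuous_on_join[OF Suc])
      qed
      show "locally_abs_continuous_on (time_dom T) x"
        unfolding locally_abs_continuous_on_def
      proof (intro allI impI)
        fix a b assume ab: "{a..b} \<subseteq> time_dom T"
        show "abs_continuous_on {a..b} x"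
        proof (cases "a \<le> b")
          case True
          then have "a \<in> time_dom T" "b \<in> time_dom T" using ab by auto
          then obtain n where "0 \<le> a" "b < s n" using td by blast
          then show ?thesis by (intro abs_continuous_on_subset[OF ac[of n]]) auto
        next
          case False
          then show ?thesis by (intro abs_continuous_on_subset[OF ac[of 0]]) auto
        qed
      qed
      show "((\<lambda>t. infdist (x t) C) \<longlongrightarrow> 0) (at_left (real_of_ereal T))" if "T < \<infinity>"
      proof (rule order_tendstoI)
        fix e :: real assume "e < 0"
        then show "\<forall>\<^sub>F t in at_left (real_of_ereal T). e < infdist (x t) C"
          by (intro always_eventually) (auto intro: less_le_trans infdist_nonneg)
      next
        fix e :: real assume "e > 0"
        then obtain J where J: "\<And>j. j \<ge> J \<Longrightarrow> R j < e"
          using order_tendstoD(2)[OF R] by (auto simp: eventually_sequentially)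
        have "infdist (x t) C < e" if t: "s J < t" "t < real_of_ereal T" for t
        proof -
          have "t \<in> time_dom T" using t s_nn[of J] \<open>T < \<infinity>\<close> \<open>0 < T\<close> by (cases T) (auto simp: time_dom_def)
          then obtain j where j: "s j \<le> t" "t < s (Suc j)" using td_cases by blast
          then have "s J < s (Suc j)" using t by simp
          then have "J \<le> j" using strict_mono_less[OF sm] by simp
          then show ?thesis using J[of j] xj[OF j] vals[of t j] j by auto
        qed
        moreover have "s J < real_of_ereal T"
          using s_td[of J] \<open>T < \<infinity>\<close> \<open>0 < T\<close> by (cases T) (auto simp: time_dom_def)
        ultimately show "\<forall>\<^sub>F t in at_left (real_of_ereal T). infdist (x t) C < e"
          by (auto simp: eventually_at_left_field)
      qed
      show "Linf_loc (time_dom T) U u"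
        unfolding Linf_loc_def
      proof (intro conjI ballI allI impI)
        show "u t \<in> U" if "t \<in> time_dom T" for t using vals'[OF that] by simp
        show "u \<in> borel_measurable (lebesgue_on (time_dom T))"
          unfolding borel_measurable_lebesgue_on_iff[OF tdm]
        proof
          fix A :: "'b set" assume A: "A \<in> sets borel"
          have "u -` A \<inter> time_dom T = (\<Union>j. (v j -` A \<inter> {s j..s (Suc j)}) \<inter> {s j..<s (Suc j)})"
          proof (intro set_eqI iffI)
            fix t assume "t \<in> u -` A \<inter> time_dom T"
            moreover from this obtain j where "s j \<le> t" "t < s (Suc j)" using td_cases by blast
            ultimately show "t \<in> (\<Union>j. (v j -` A \<inter> {s j..s (Suc j)}) \<inter> {s j..<s (Suc j)})" using uj by auto
          next
            fix t assume "t \<in> (\<Union>j. (v j -` A \<inter> {s j..s (Suc j)}) \<inter> {s j..<s (Suc j)})"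
            then obtain j where j: "v j t \<in> A" "s j \<le> t" "t < s (Suc j)" by auto
            then have "t \<in> time_dom T" using td order_trans[OF s_nn j(2)] by blast
            then show "t \<in> u -` A \<inter> time_dom T" using uj[OF j(2,3)] j(1) by simp
          qed
          moreover have pre: "v j -` A \<inter> {s j..s (Suc j)} \<in> sets lebesgue" for j
            using meas[of j] A by (subst (asm) borel_measurable_lebesgue_on_iff) auto
          have "(\<Union>j. (v j -` A \<inter> {s j..s (Suc j)}) \<inter> {s j..<s (Suc j)}) \<in> sets lebesgue"
            by (rule sets.countable_UN'', simp, rule sets.Int, rule pre, simp)
          ultimately show "u -` A \<inter> time_dom T \<in> sets lebesgue" by simp
        qed
        fix K assume K: "compact K \<and> K \<subseteq> time_dom T"
        \<comment> \<open>A compact subset of the time domain ends before some \<open>s n\<close>,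
          so finitely many of the bounds \<open>M j\<close> suffice, although these may blow up
          along the sequence.\<close>
        obtain n where n: "\<And>t. t \<in> K \<Longrightarrow> t < s n"
        proof (cases "K = {}")
          case False
          then obtain m where m: "m \<in> K" "\<And>t. t \<in> K \<Longrightarrow> t \<le> m" using compact_attains_sup K by metis
          then obtain n where "m < s n" using K td by blast
          then show ?thesis using that m(2) by (meson le_less_trans)
        qed (use that in auto)
        have "K \<in> sets lebesgue" using K by (simp add: fmeasurableD lmeasurable_compact)
        show "\<exists>M. AE t in lebesgue_on K. norm (u t) \<le> M"
        proof (intro exI[of _ "Max (M ` {..n})"], subst AE_lebesgue_on_iff_negligible)
          show "K \<in> sets lebesgue" by fact
          show "negligible {t \<in> K. \<not> norm (u t) \<le> Max (M ` {..n})}"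
          proof (rule negligible_subset[OF negN], rule subsetI, rule ccontr)
            fix t assume t: "t \<in> {t \<in> K. \<not> norm (u t) \<le> Max (M ` {..n})}" "t \<notin> ?N"
            then obtain j where j: "s j \<le> t" "norm (u t) \<le> M j" using good K by blast
            then have "s j < s n" using t n by fastforce
            then have "j \<le> n" using strict_mono_less[OF sm] by simp
            then have "M j \<le> Max (M ` {..n})" by (intro Max_ge) auto
            then show False using t j by auto
          qed
        qed
      qed
    qed
  qed
qed

section \<open>Invariance of controllability under rescaling\<close>

lemma GAC_rescale:
  fixes C :: "'a::euclidean_space set" and U :: "'b::euclidean_space set"
  assumes C: "closed C" "C \<noteq> {}" "compact (frontier C)"
    and \<sigma>: "continuous_on {0<..} \<sigma>"
    and h: "h \<in> borel_measurable borel"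
    and h_bd: "\<And>M. 0 \<le> M \<Longrightarrow> \<exists>lo hi. 0 < lo \<and> (\<forall>r. 0 \<le> r \<and> r \<le> M \<longrightarrow> lo \<le> h r \<and> h r \<le> hi)"
    and g: "\<And>x u. g x u = f x u /\<^sub>R h (norm u)"
    and "GAC C U \<sigma> f"
  shows "GAC C U \<sigma> g"
proof -
  obtain \<beta> where KL: "class_KL \<beta>" and
    traj: "\<And>z. z \<notin> C \<Longrightarrow> \<exists>T x u. admissible_pair C U f T x u \<and> extended_past C T x \<and>
            x 0 = z \<and> (\<forall>t\<ge>0. infdist (x t) C \<le> \<beta> (infdist z C) t) \<and>
            (AE t in lebesgue_on (time_dom T). norm (u t) \<le> \<sigma> (infdist (x t) C))"
    using \<open>GAC C U \<sigma> f\<close> unfolding GAC_def by blast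
  define \<alpha> where "\<alpha> r = \<beta> r 0" for r
  \<comment> \<open>Piece \<open>k\<close> leads from distances in \<open>(\<rho> k, D k]\<close> down to \<open>\<rho> k\<close>.\<close>
  define D :: "int \<Rightarrow> real" where "D k = 2 powr (of_int k + 1)" for k
  define \<rho> :: "int \<Rightarrow> real" where "\<rho> k = 2 powr of_int k" for k
  have D_pos: "0 < D k" and \<rho>_pos: "0 < \<rho> k" for k by (auto simp: D_def \<rho>_def)
  \<comment> \<open>\<open>M\<close> and \<theta> are chosen before \<open>z\<close>: this
    uniformity over a level is what the descent rate is built from. The decay of \<beta> yields a
    time \<open>S\<close> for reaching \<rho> k, boundedness of \<sigma> on the compact range of
    distances yields \<open>M\<close>, and \<theta> is hi * S.\<close>
  have "\<exists>M \<theta>. \<forall>z. z \<notin> C \<longrightarrow> \<rho> k < infdist z C \<longrightarrow> infdist z C \<le> D k \<longrightarrow>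
      (\<exists>\<tau> y v. trajectory_piece C U \<sigma> g (\<alpha> (D k)) M 0 \<tau> y v \<and> y 0 = z \<and>
         infdist (y \<tau>) C = \<rho> k \<and> \<tau> \<le> \<theta>)" for k
  proof -
    have "(\<beta> (D k) \<longlongrightarrow> 0) at_top" using KL D_pos[of k] unfolding class_KL_def by auto
    then have "\<forall>\<^sub>F t in at_top. \<beta> (D k) t < \<rho> k \<and> 0 \<le> t"
      using order_tendstoD(2)[OF _ \<rho>_pos] eventually_ge_at_top[of 0] by (fastforce intro: eventually_conj)
    then obtain S where S: "\<beta> (D k) S < \<rho> k" "0 \<le> S"
      using eventually_happens'[OF trivial_limit_at_top_linorder] by blast
    have "continuous_on {\<rho> k..\<beta> (D k) 0} \<sigma>"
      by (rule continuous_on_subset[OF \<sigma>]) (use \<rho>_pos[of k] in auto)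
    then have "bounded (\<sigma> ` {\<rho> k..\<beta> (D k) 0})"
      by (intro compact_imp_bounded compact_continuous_image) auto
    then obtain M where M: "0 < M" "\<And>r. r \<in> {\<rho> k..\<beta> (D k) 0} \<Longrightarrow> \<bar>\<sigma> r\<bar> \<le> M"
      unfolding bounded_pos by auto
    obtain lo hi where h: "0 < lo" "\<And>r. 0 \<le> r \<Longrightarrow> r \<le> M \<Longrightarrow> lo \<le> h r \<and> h r \<le> hi"
      using h_bd[of M] M(1) by auto
    have "lo \<le> hi" using h(2)[of 0] M(1) by simp
    show ?thesis
    proof (rule exI[of _ M], rule exI[of _ "hi * S"], intro allI impI)
      fix z assume z: "z \<notin> C" "\<rho> k < infdist z C" "infdist z C \<le> D k"
      obtain T x u where x: "admissible_pair C U f T x u" "x 0 = z"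
        "\<And>t. 0 \<le> t \<Longrightarrow> infdist (x t) C \<le> \<beta> (infdist (x 0) C) t"
        "AE t in lebesgue_on (time_dom T). norm (u t) \<le> \<sigma> (infdist (x t) C)"
        using traj[OF z(1)] by blast
      obtain \<tau> where \<tau>: "trajectory_piece C U \<sigma> f (\<beta> (D k) 0) M 0 \<tau> x u" "infdist (x \<tau>) C = \<rho> k" "\<tau> \<le> S"
      proof (rule ex_descending_piece[OF KL x(1,3,4) \<rho>_pos[of k], of "D k" S M])
        show "\<rho> k < infdist (x 0) C" "infdist (x 0) C \<le> D k" using z x(2) by auto
        show "0 \<le> S" "\<beta> (D k) S \<le> \<rho> k" using S by auto
        show "\<sigma> r \<le> M" if "\<rho> k \<le> r" "r \<le> \<beta> (D k) 0" for r using M(2)[of r] that by auto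
      qed (assumption | rule that)+
      obtain \<tau>' y v where y: "trajectory_piece C U \<sigma> g (\<beta> (D k) 0) M 0 \<tau>' y v" "y 0 = x 0" "y \<tau>' = x \<tau>" "\<tau>' \<le> hi * \<tau>"
        by (rule trajectory_piece_time_change[OF \<tau>(1) assms(5) h(1) h(2) \<open>lo \<le> hi\<close> g]) (assumption | rule that)+
      have "hi * \<tau> \<le> hi * S" using \<tau>(3) h(1) \<open>lo \<le> hi\<close> by (intro mult_left_mono) auto
      then show "\<exists>\<tau> y v. trajectory_piece C U \<sigma> g (\<alpha> (D k)) M 0 \<tau> y v \<and> y 0 = z \<and>
         infdist (y \<tau>) C = \<rho> k \<and> \<tau> \<le> hi * S"
        using y \<tau>(2) x(2) unfolding \<alpha>_def by (intro exI[of _ \<tau>'] exI[of _ y] exI[of _ v]) auto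
    qed
  qed
  then obtain M \<Theta> where step: "\<And>k z. z \<notin> C \<Longrightarrow> \<rho> k < infdist z C \<Longrightarrow> infdist z C \<le> D k \<Longrightarrow>
      \<exists>\<tau> y v. trajectory_piece C U \<sigma> g (\<alpha> (D k)) (M k) 0 \<tau> y v \<and> y 0 = z \<and>
         infdist (y \<tau>) C = \<rho> k \<and> \<tau> \<le> \<Theta> k"
    by metis
  have \<alpha>: "continuous_on {0..} \<alpha>" "strict_mono_on {0..} \<alpha>" "\<alpha> 0 = 0" "\<not> bdd_above (\<alpha> ` {0..})"
  proof -
    have "continuous_on {0..} (\<lambda>r. (\<lambda>(r, t). \<beta> r t) (r, 0))"
      by (rule continuous_on_compose2[of "{0..} \<times> {0..}"])
         (use KL in \<open>auto simp: class_KL_def intro!: continuous_intros\<close>)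
    then show "continuous_on {0..} \<alpha>" by (simp add: \<alpha>_def)
  qed (use KL in \<open>auto simp: class_KL_def \<alpha>_def[abs_def]\<close>)
  obtain \<beta>' where KL': "class_KL \<beta>'" and \<beta>': "\<And>k j R s. 2 powr of_int k < R \<Longrightarrow> 0 \<le> s \<Longrightarrow>
      s \<le> (\<Sum>i\<le>j. \<Theta> (k - int i)) \<Longrightarrow> \<alpha> (2 powr (of_int k - real j + 1)) \<le> \<beta>' R s"
    by (rule ex_class_KL_dyadic[OF \<alpha>, of \<Theta>]) (rule that)
  show ?thesis unfolding GAC_def
  proof (intro exI[of _ \<beta>'] conjI KL' allI impI)
    fix z assume "z \<notin> C"
    then have "infdist z C > 0"
      using C in_closed_iff_infdist_zero[of C z] infdist_nonneg[of z C] by fastforce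
    \<comment> \<open>The rounding places the distance of \<open>z\<close> in (2^k, 2^(k+1)]. The
      upper end belongs to the level because each later piece starts exactly there, at \<rho> (k - j
      + 1) = D (k - j).\<close>
    define k where "k = \<lceil>log 2 (infdist z C)\<rceil> - 1"
    have kz: "\<rho> k < infdist z C" "infdist z C \<le> D k"
    proof -
      have "of_int k < log 2 (infdist z C)" "log 2 (infdist z C) \<le> of_int k + 1"
        unfolding k_def by linarith+
      then show "\<rho> k < infdist z C" "infdist z C \<le> D k"
        using \<open>infdist z C > 0\<close> by (auto simp: \<rho>_def D_def less_log_iff log_le_iff)
    qed
    have D\<rho>: "\<rho> (i - 1) < \<rho> i" "\<rho> i = D (i - 1)" for i by (auto simp: \<rho>_def D_def)
    \<comment> \<open>The clause for j = 0 records that the chain starts at \<open>z\<close>;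
      dependent choice alone would only give some starting point of the right level.\<close>
    define P where "P j w \<longleftrightarrow> w \<notin> C \<and> \<rho> (k - int j) < infdist w C \<and> infdist w C \<le> D (k - int j) \<and> (j = 0 \<longrightarrow> w = z)" for j w
    define Q where "Q j w w' \<longleftrightarrow> (\<exists>\<tau> y v. trajectory_piece C U \<sigma> g (\<alpha> (D (k - int j))) (M (k - int j)) 0 \<tau> y v \<and>
        y 0 = w \<and> y \<tau> = w' \<and> \<tau> \<le> \<Theta> (k - int j))" for j w w'
    have "\<exists>Z. \<forall>j. P j (Z j) \<and> Q j (Z j) (Z (Suc j))"
    proof (rule dependent_nat_choice)
      show "\<exists>w. P 0 w" using kz \<open>z \<notin> C\<close> by (auto simp: P_def)
      fix w j assume "P j w"
      then obtain \<tau> y v where y: "trajectory_piece C U \<sigma> g (\<alpha> (D (k - int j))) (M (k - int j)) 0 \<tau> y v" "y 0 = w"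
         "infdist (y \<tau>) C = \<rho> (k - int j)" "\<tau> \<le> \<Theta> (k - int j)"
        using step[of w "k - int j"] by (auto simp: P_def)
      have "y \<tau> \<notin> C" using y(1) by (auto simp: trajectory_piece_def)
      then have "P (Suc j) (y \<tau>)" using y(3) D\<rho>[of "k - int j"] by (simp add: P_def algebra_simps)
      moreover have "Q j w (y \<tau>)" using y by (auto simp: Q_def)
      ultimately show "\<exists>w'. P (Suc j) w' \<and> Q j w w'" by blast
    qed
    then obtain Z where Z: "\<And>j. P j (Z j)" "\<And>j. Q j (Z j) (Z (Suc j))" by blast
    then have "\<forall>j. \<exists>\<tau> y v. trajectory_piece C U \<sigma> g (\<alpha> (D (k - int j))) (M (k - int j)) 0 \<tau> y v \<and>
        y 0 = Z j \<and> y \<tau> = Z (Suc j) \<and> \<tau> \<le> \<Theta> (k - int j)"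
      unfolding Q_def by blast
    then obtain \<tau> y v where y: "\<And>j. trajectory_piece C U \<sigma> g (\<alpha> (D (k - int j))) (M (k - int j)) 0 (\<tau> j) (y j) (v j)"
        "\<And>j. y j 0 = Z j" "\<And>j. y j (\<tau> j) = Z (Suc j)" "\<And>j. \<tau> j \<le> \<Theta> (k - int j)"
      by metis
    define s where "s j = (\<Sum>i<j. \<tau> i)" for j
    have s_Suc: "s (Suc j) = s j + \<tau> j" for j by (simp add: s_def)
    have "\<forall>j. \<exists>y' v'. trajectory_piece C U \<sigma> g (\<alpha> (D (k - int j))) (M (k - int j)) (s j) (s (Suc j)) y' v' \<and>
        (\<forall>t. y' (s j + t) = y j t)"
      unfolding s_Suc using trajectory_piece_shift[OF y(1)] by metis
    then obtain y' v' where y': "\<And>j. trajectory_piece C U \<sigma> g (\<alpha> (D (k - int j))) (M (k - int j)) (s j) (s (Suc j)) (y' j) (v' j)"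
        "\<And>j t. y' j (s j + t) = y j t"
      by metis
    have R0: "(\<lambda>j. \<alpha> (D (k - int j))) \<longlonglongrightarrow> 0"
    proof -
      have "(\<lambda>j. D k * (1 / 2) ^ j) \<longlonglongrightarrow> 0"
        by (intro tendsto_mult_right_zero LIMSEQ_power_zero) simp
      moreover have "D (k - int j) = D k * (1 / 2) ^ j" for j
        by (simp add: D_def powr_add powr_diff powr_realpow power_divide)
      ultimately have "(\<lambda>j. D (k - int j)) \<longlonglongrightarrow> 0" by simp
      then have "(\<lambda>j. \<alpha> (D (k - int j))) \<longlonglongrightarrow> \<alpha> 0"
        by (rule continuous_on_tendsto_compose[OF \<alpha>(1)]) (auto intro: always_eventually less_imp_le D_pos)
      then show ?thesis using \<alpha>(3) by simp
    qed
    have "y' j (s (Suc j)) = y' (Suc j) (s (Suc j))" for j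
      using y'(2)[of j "\<tau> j"] y'(2)[of "Suc j" 0] y(2)[of "Suc j"] y(3)[of j] by (simp add: s_Suc)
    moreover have "s 0 = 0" by (simp add: s_def)
    ultimately obtain T x u where x: "admissible_pair C U g T x u" "extended_past C T x" "x 0 = y' 0 0"
      "AE t in lebesgue_on (time_dom T). norm (u t) \<le> \<sigma> (infdist (x t) C)"
      "\<And>t. 0 \<le> t \<Longrightarrow> x t \<in> C \<or> (\<exists>j. t < s (Suc j) \<and> infdist (x t) C \<le> \<alpha> (D (k - int j)))"
      using concatenate_trajectory_pieces[OF C _ R0 y'(1), where thesis = thesis] that by blast
    have "x 0 = z" using x(3) y'(2)[of 0 0] y(2)[of 0] Z(1)[of 0] \<open>s 0 = 0\<close> by (simp add: P_def)
    moreover have "infdist (x t) C \<le> \<beta>' (infdist z C) t" if t: "0 \<le> t" for t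
    proof (cases "x t \<in> C")
      case True
      then show ?thesis using KL' t infdist_nonneg[of z C] by (simp add: class_KL_def)
    next
      case False
      then obtain j where j: "t < s (Suc j)" "infdist (x t) C \<le> \<alpha> (D (k - int j))" using x(5)[OF t] by blast
      \<comment> \<open>Piece \<open>j\<close> is not yet over at time \<open>t\<close>, so
        \<open>t\<close> is below the sum of the durations allowed for the levels down to k - j, the
        situation covered by \<beta>'.\<close>
      have "s (Suc j) \<le> (\<Sum>i\<le>j. \<Theta> (k - int i))"
        unfolding s_def lessThan_Suc_atMost using y(4) by (intro sum_mono)
      then have "\<alpha> (2 powr (of_int k - real j + 1)) \<le> \<beta>' (infdist z C) t"
        using \<beta>'[of k "infdist z C" t j] kz(1) t j(1) by (simp add: \<rho>_def)
      then show ?thesis using j(2) by (simp add: D_def)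
    qed
    ultimately show "\<exists>T x u. admissible_pair C U g T x u \<and> extended_past C T x \<and> x 0 = z \<and>
        (\<forall>t\<ge>0. infdist (x t) C \<le> \<beta>' (infdist z C) t) \<and>
        (AE t in lebesgue_on (time_dom T). norm (u t) \<le> \<sigma> (infdist (x t) C))"
      using x by blast
  qed
qed

theorem theorem3p1:
  fixes C :: "(real ^ 'n) set" and U :: "(real ^ 'm) set"
    and f :: "real ^ 'n \<Rightarrow> real ^ 'm \<Rightarrow> real ^ 'n"
    and \<nu> \<sigma> :: "real \<Rightarrow> real"
  assumes "C \<noteq> {}" and "closed C" and "compact (frontier C)"
    and "closed U" and "cone U"
    and "continuous_on ((- C) \<times> U) (\<lambda>(x, u). f x u)"
    and "strict_mono_on {0..} \<nu>" and "bij_betw \<nu> {0..} {0..}"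
    and "\<And>K. compact K \<Longrightarrow> K \<subseteq> - C \<Longrightarrow>
           uniformly_continuous_on (K \<times> U) (\<lambda>(x, u). rescaled \<nu> f x u)"
    and "\<And>R. R > 0 \<Longrightarrow>
           bounded ((\<lambda>(x, u). rescaled \<nu> f x u) ` (({x. infdist x C \<le> R} - C) \<times> U))"
    and "continuous_on {0<..} \<sigma>" and "\<And>r. r > 0 \<Longrightarrow> \<sigma> r > 0"
  shows "GAC C U \<sigma> f \<longleftrightarrow> GAC C U \<sigma> (rescaled \<nu> f)"
proof -
  \<comment> \<open>\<nu> is only known on nonnegative arguments; the maximum makes \<open>h\<close>
    monotone on the whole line, hence Borel.\<close>
  define h where "h r = 1 + \<nu> (max 0 r)" for r
  have \<nu>_nn: "0 \<le> \<nu> r" if "0 \<le> r" for r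
    using bij_betw_apply[OF assms(8), of r] that by simp
  have \<nu>_mono: "\<nu> r \<le> \<nu> r'" if "0 \<le> r" "r \<le> r'" for r r'
    using strict_mono_on_leD[OF assms(7)] that by simp
  have h_meas: "h \<in> borel_measurable borel"
    by (rule borel_measurable_mono) (auto intro!: monoI \<nu>_mono simp: h_def)
  have h_pos: "0 < h r" for r using \<nu>_nn[of "max 0 r"] by (simp add: h_def)
  have h_bd: "1 \<le> h r \<and> h r \<le> h M" if "0 \<le> r" "r \<le> M" for r M
    using that \<nu>_nn[of r] \<nu>_mono[of r M] by (simp add: h_def)
  show ?thesis
  proof
    assume "GAC C U \<sigma> f"
    then show "GAC C U \<sigma> (rescaled \<nu> f)"
    proof (rule GAC_rescale[OF assms(2,1,3,11) h_meas, rotated 2])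
      show "\<exists>lo hi. 0 < lo \<and> (\<forall>r. 0 \<le> r \<and> r \<le> M \<longrightarrow> lo \<le> h r \<and> h r \<le> hi)" if "0 \<le> M" for M
        using h_bd by (intro exI[of _ 1] exI[of _ "h M"]) auto
      show "rescaled \<nu> f x u = f x u /\<^sub>R h (norm u)" for x u by (simp add: rescaled_def h_def)
    qed
  next
    \<comment> \<open>Backwards the rate is 1 / h: dividing the rescaled dynamics by it restores
      \<open>f\<close>, and on norms up to \<open>M\<close> it lies between 1 / h M and 1.\<close>
    assume "GAC C U \<sigma> (rescaled \<nu> f)"
    then show "GAC C U \<sigma> f"
    proof (rule GAC_rescale[OF assms(2,1,3,11), of "\<lambda>r. 1 / h r", rotated 3])
      show "(\<lambda>r. 1 / h r) \<in> borel_measurable borel" using h_meas by measurable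
      show "\<exists>lo hi. 0 < lo \<and> (\<forall>r. 0 \<le> r \<and> r \<le> M \<longrightarrow> lo \<le> 1 / h r \<and> 1 / h r \<le> hi)" if "0 \<le> M" for M
        using h_bd h_pos by (intro exI[of _ "1 / h M"] exI[of _ 1]) (auto simp: frac_le)
      show "f x u = rescaled \<nu> f x u /\<^sub>R (1 / h (norm u))" for x u
        using h_pos[of "norm u"] by (simp add: rescaled_def h_def)
    qed
  qed
qed

end
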